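(* Let $\mathbb{K}$ be a field, let $\Delta=\langle\sigma_1,\dots,\sigma_s\rangle$ be a balanced $d$-dimensional $\mathbb{K}$-homology sphere on vertex set $[n]$ with facets $\sigma_1,\dots,\sigma_s$, let $\rho$ be a coloring of $\Delta$ with $d+1$ colors, and let $\theta_1,\dots,\theta_{d+1}$ be the corresponding colored sop. Then the Macaulay dual generator of $I_\Delta+(\theta_1,\dots,\theta_{d+1})$ is the polynomial $$F_{\Delta,\rho}=\sum_{\sigma\in B_1}x_\sigma-\sum_{\sigma\in B_2}x_\sigma,$$ where $x_\sigma=\prod_{i\in\sigma}x_i$ and $B_1\cup B_2$ is a bipartition of the facet-ridge graph $G(\Delta)$.
   Context: $R=\mathbb{K}[x_1,\dots,x_n]$ and $I_\Delta=(\prod_{i\in\sigma}x_i : \sigma\notin\Delta)\subset R$ is the Stanley-Reisner ideal; every element of $[n]$ is a vertex of $\Delta$. $\Delta$ is a $\mathbb{K}$-homology sphere if for every face $\sigma\in\Delta$ (including $\emptyset$), $\tilde H_i(\mathrm{link}_\Delta(\sigma);\mathbb{K})$ is $\mathbb{K}$ for $i=\dim \mathrm{link}_\Delta(\sigma)$ and $0$ otherwise, where $\mathrm{link}_\Delta(\sigma)=\{\tau\in\Delta:\tau\cup\sigma\in\Delta,\ \tau\cap\sigma=\emptyset\}$. A $d$-dimensional complex is balanced if there is a coloring $\rho:[n]\to[d+1]$ with $\rho(u)\ne\rho(v)$ whenever $\{u,v\}\in\Delta$, $u\ne v$. The colored sop with respect to $\rho$ is $\theta_i=\sum_{v\in\rho^{-1}(i)}x_v$,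 $i\in[d+1]$ (Stanley: it is a system of parameters of $I_\Delta$ when $\Delta$ is Cohen-Macaulay). The facet-ridge graph $G(\Delta)$ has the facets of $\Delta$ as vertices, two facets being adjacent iff their intersection is a ridge (a $(d-1)$-dimensional face). It is known that $G(\Delta)$ is bipartite when $\Delta$ is a balanced $\mathbb{K}$-homology sphere; a bipartition is a partition of its vertex set into two independent sets $B_1,B_2$. Inverse systems: $R$ acts on a polynomial ring $S=\mathbb{K}[y_1,\dots,y_n]$ by contraction, $x^{\mathbf a}\circ y^{\mathbf b}=y^{\mathbf b-\mathbf a}$ if $a_i\le b_i$ for all $i$ and $0$ otherwise, extended linearly. For a homogeneous artinian ideal $I\subset R$, $I^{-1}=\{F\in S: g\circ F=0 \text{ for all } g\in I\}$. When $R/I$ is artinian Gorenstein, $I^{-1}$ is generated as an $R$-module by a single homogeneous polynomial $F$, unique up to a nonzero scalar, called the Macaulay dual generator; it is regarded as a polynomial in $x_1,\dots,x_n$ by replacing each $y_i$ by $x_i$. *)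

theory Defs
  imports Complex_Main "HOL-Library.Poly_Mapping"
begin

section \<open>Simplicial complexes\<close>

text \<open>
  The vertex set \<open>[n]\<close> is a finite linearly ordered type \<open>'v\<close> with \<open>n\<close> elements; the order is
  only used for the signs of the simplicial boundary map.
\<close>

definition simplicial_complex :: "'v::finite set set \<Rightarrow> bool" where
  "simplicial_complex \<Delta> \<longleftrightarrow>
     {} \<in> \<Delta> \<and> (\<forall>v. {v} \<in> \<Delta>) \<and> (\<forall>\<sigma>\<in>\<Delta>. \<forall>\<tau>. \<tau> \<subseteq> \<sigma> \<longrightarrow> \<tau> \<in> \<Delta>)"

definition face_dim :: "'v set \<Rightarrow> int" where
  "face_dim \<sigma> = int (card \<sigma>) - 1"

definition complex_dim :: "'v::finite set set \<Rightarrow> int" where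
  "complex_dim \<Delta> = Max (face_dim ` \<Delta>)"

definition facets :: "'v set set \<Rightarrow> 'v set set" where
  "facets \<Delta> = {\<sigma>\<in>\<Delta>. \<forall>\<tau>\<in>\<Delta>. \<sigma> \<subseteq> \<tau> \<longrightarrow> \<tau> = \<sigma>}"

definition link :: "'v set set \<Rightarrow> 'v set \<Rightarrow> 'v set set" where
  "link \<Delta> \<sigma> = {\<tau>\<in>\<Delta>. \<tau> \<union> \<sigma> \<in> \<Delta> \<and> \<tau> \<inter> \<sigma> = {}}"

section \<open>Reduced simplicial homology with coefficients in a field\<close>

text \<open>
  Degrees are integers, and the empty face spans the chains of degree \<open>-1\<close> (augmented complex).
\<close>

definition chains :: "'v set set \<Rightarrow> int \<Rightarrow> ('v set \<Rightarrow>\<^sub>0 'k::field) set" where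
  "chains \<Delta> i = {c. Poly_Mapping.keys c \<subseteq> {\<tau>\<in>\<Delta>. face_dim \<tau> = i}}"

definition boundary_map ::
  "('v::{finite,linorder} set \<Rightarrow>\<^sub>0 'k::field) \<Rightarrow> ('v set \<Rightarrow>\<^sub>0 'k)" where
  "boundary_map c = (\<Sum>\<tau>\<in>Poly_Mapping.keys c. \<Sum>v\<in>\<tau>.
     Poly_Mapping.single (\<tau> - {v}) ((-1) ^ card {u\<in>\<tau>. u < v} * Poly_Mapping.lookup c \<tau>))"

definition cycles ::
  "'v::{finite,linorder} set set \<Rightarrow> int \<Rightarrow> ('v set \<Rightarrow>\<^sub>0 'k::field) set" where
  "cycles \<Delta> i = {c \<in> chains \<Delta> i. boundary_map c = 0}"

definition boundaries ::
  "'v::{finite,linorder} set set \<Rightarrow> int \<Rightarrow> ('v set \<Rightarrow>\<^sub>0 'k::field) set" where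
  "boundaries \<Delta> i = boundary_map ` chains \<Delta> (i + 1)"

definition homology_class ::
  "'v::{finite,linorder} set set \<Rightarrow> int \<Rightarrow> ('v set \<Rightarrow>\<^sub>0 'k::field) \<Rightarrow> ('v set \<Rightarrow>\<^sub>0 'k) set" where
  "homology_class \<Delta> i z = {z + b |b. b \<in> boundaries \<Delta> i}"

definition reduced_homology ::
  "'v::{finite,linorder} set set \<Rightarrow> int \<Rightarrow> ('v set \<Rightarrow>\<^sub>0 'k::field) set set" where
  "reduced_homology \<Delta> i = homology_class \<Delta> i ` cycles \<Delta> i"

definition scale_chain :: "'k::field \<Rightarrow> ('v set \<Rightarrow>\<^sub>0 'k) \<Rightarrow> ('v set \<Rightarrow>\<^sub>0 'k)" where
  "scale_chain a c = Poly_Mapping.map ((*) a) c"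

definition homology_zero :: "'k::field itself \<Rightarrow> 'v::{finite,linorder} set set \<Rightarrow> int \<Rightarrow> bool" where
  "homology_zero _ \<Delta> i \<longleftrightarrow>
     reduced_homology \<Delta> i = {homology_class \<Delta> i (0 :: 'v set \<Rightarrow>\<^sub>0 'k)}"

text \<open>
  The quotient of cycles by boundaries is isomorphic to the field as a vector space: \<open>h\<close> is a linear
  bijection, the operations on cosets being given by representatives.
\<close>

definition homology_field :: "'k::field itself \<Rightarrow> 'v::{finite,linorder} set set \<Rightarrow> int \<Rightarrow> bool" where
  "homology_field _ \<Delta> i \<longleftrightarrow>
     (\<exists>h :: ('v set \<Rightarrow>\<^sub>0 'k) set \<Rightarrow> 'k.
        bij_betw h (reduced_homology \<Delta> i) UNIV \<and>
        (\<forall>z\<in>cycles \<Delta> i. \<forall>w\<in>cycles \<Delta> i.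
           h (homology_class \<Delta> i (z + w)) = h (homology_class \<Delta> i z) + h (homology_class \<Delta> i w)) \<and>
        (\<forall>a. \<forall>z\<in>cycles \<Delta> i.
           h (homology_class \<Delta> i (scale_chain a z)) = a * h (homology_class \<Delta> i z)))"

definition homology_sphere :: "'k::field itself \<Rightarrow> 'v::{finite,linorder} set set \<Rightarrow> bool" where
  "homology_sphere K \<Delta> \<longleftrightarrow> simplicial_complex \<Delta> \<and>
     (\<forall>\<sigma>\<in>\<Delta>. \<forall>i. if i = complex_dim (link \<Delta> \<sigma>)
                  then homology_field K (link \<Delta> \<sigma>) i
                  else homology_zero K (link \<Delta> \<sigma>) i)"

section \<open>Colorings and the facet-ridge graph\<close>

definition balanced_coloring :: "'v::finite set set \<Rightarrow> nat \<Rightarrow> ('v \<Rightarrow> nat) \<Rightarrow> bool" where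
  "balanced_coloring \<Delta> d \<rho> \<longleftrightarrow> complex_dim \<Delta> = int d \<and> (\<forall>v. \<rho> v \<in> {1..d + 1}) \<and>
     (\<forall>u v. {u, v} \<in> \<Delta> \<and> u \<noteq> v \<longrightarrow> \<rho> u \<noteq> \<rho> v)"

definition facet_ridge_adj :: "'v::finite set set \<Rightarrow> 'v set \<Rightarrow> 'v set \<Rightarrow> bool" where
  "facet_ridge_adj \<Delta> \<sigma> \<tau> \<longleftrightarrow> \<sigma> \<in> facets \<Delta> \<and> \<tau> \<in> facets \<Delta> \<and> \<sigma> \<noteq> \<tau> \<and>
     \<sigma> \<inter> \<tau> \<in> \<Delta> \<and> face_dim (\<sigma> \<inter> \<tau>) = complex_dim \<Delta> - 1"

definition facet_ridge_bipartition ::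
  "'v::finite set set \<Rightarrow> 'v set set \<Rightarrow> 'v set set \<Rightarrow> bool" where
  "facet_ridge_bipartition \<Delta> B1 B2 \<longleftrightarrow> B1 \<union> B2 = facets \<Delta> \<and> B1 \<inter> B2 = {} \<and>
     (\<forall>\<sigma>\<in>B1. \<forall>\<tau>\<in>B1. \<not> facet_ridge_adj \<Delta> \<sigma> \<tau>) \<and>
     (\<forall>\<sigma>\<in>B2. \<forall>\<tau>\<in>B2. \<not> facet_ridge_adj \<Delta> \<sigma> \<tau>)"

section \<open>Polynomials and Macaulay inverse systems\<close>

text \<open>
  Exponent vectors are \<open>'v \<Rightarrow>\<^sub>0 nat\<close>. The ring \<open>R\<close> and the module \<open>S\<close> on which it acts by contraction
  are represented by the same type, so that the replacement of each \<open>y\<^sub>i\<close> by \<open>x\<^sub>i\<close> is implicit.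
\<close>

type_synonym ('v, 'k) mpoly = "('v \<Rightarrow>\<^sub>0 nat) \<Rightarrow>\<^sub>0 'k"

definition var :: "'v \<Rightarrow> ('v, 'k::field) mpoly" where
  "var v = Poly_Mapping.single (Poly_Mapping.single v 1) 1"

definition face_monomial :: "'v::finite set \<Rightarrow> ('v, 'k::field) mpoly" where
  "face_monomial \<sigma> = (\<Prod>v\<in>\<sigma>. var v)"

definition ideal_generated :: "('v, 'k::field) mpoly set \<Rightarrow> ('v, 'k) mpoly set" where
  "ideal_generated G = module.span (*) G"

definition ideal_plus ::
  "('v, 'k::field) mpoly set \<Rightarrow> ('v, 'k) mpoly set \<Rightarrow> ('v, 'k) mpoly set" where
  "ideal_plus I J = {f + g |f g. f \<in> I \<and> g \<in> J}"

definition stanley_reisner_ideal :: "'v::finite set set \<Rightarrow> ('v, 'k::field) mpoly set" where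
  "stanley_reisner_ideal \<Delta> = ideal_generated {face_monomial \<sigma> |\<sigma>. \<sigma> \<notin> \<Delta>}"

definition colored_sop :: "('v::finite \<Rightarrow> nat) \<Rightarrow> nat \<Rightarrow> ('v, 'k::field) mpoly" where
  "colored_sop \<rho> i = (\<Sum>v | \<rho> v = i. var v)"

definition contract :: "('v, 'k::field) mpoly \<Rightarrow> ('v, 'k) mpoly \<Rightarrow> ('v, 'k) mpoly" where
  "contract g F = (\<Sum>a\<in>Poly_Mapping.keys g. \<Sum>b\<in>Poly_Mapping.keys F.
     if \<forall>v. Poly_Mapping.lookup a v \<le> Poly_Mapping.lookup b v
     then Poly_Mapping.single (b - a) (Poly_Mapping.lookup g a * Poly_Mapping.lookup F b)
     else 0)"

definition inverse_system :: "('v, 'k::field) mpoly set \<Rightarrow> ('v, 'k) mpoly set" where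
  "inverse_system I = {F. \<forall>g\<in>I. contract g F = 0}"

definition homogeneous :: "('v::finite, 'k::field) mpoly \<Rightarrow> bool" where
  "homogeneous F \<longleftrightarrow>
     (\<exists>k. \<forall>a\<in>Poly_Mapping.keys F. (\<Sum>v\<in>UNIV. Poly_Mapping.lookup a v) = k)"

text \<open>
  By Macaulay duality, a homogeneous ideal whose inverse system in \<open>S\<close> is generated by a single
  nonzero homogeneous polynomial has an artinian Gorenstein quotient, so this need not be demanded
  separately.
\<close>

definition macaulay_dual_generator ::
  "('v::finite, 'k::field) mpoly set \<Rightarrow> ('v, 'k) mpoly \<Rightarrow> bool" where
  "macaulay_dual_generator I F \<longleftrightarrow>
     F \<noteq> 0 \<and> homogeneous F \<and> inverse_system I = {contract g F |g. True}"

end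

theory Submission
  imports Defs
begin

text \<open>
  The inverse system of the ideal consists of the polynomials \<open>\<Sum>\<tau>\<in>\<Delta>. c \<tau> x\<^sub>\<tau>\<close> such that, for every face
  \<open>\<tau>\<close> and colour \<open>i\<close> missing from \<open>\<tau>\<close>, the coefficients \<open>c (\<tau> \<union> {v})\<close> with \<open>\<rho> v = i\<close> add up to
  \<open>0\<close>: the colour sums kill all squares because two vertices of one colour never form a face. Up to
  signs, the part of \<open>c\<close> with colour set \<open>S\<close> is a top cycle of the subcomplex of faces with colours in
  \<open>S\<close>. For the set of all colours the cycle space is a line, spanned by the signs of the bipartition,
  since every ridge lies in exactly two facets. For smaller \<open>S\<close> and a new colour \<open>i\<close>, the cycle bounds in
  the subcomplex with colours \<open>S \<union> {i}\<close> (rank selection preserves acyclicity below the top degree), so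
  it is a sum of cycles in the links of the vertices of colour \<open>i\<close>; by induction these are
  contractions of the dual forms of the links, and the dual form of the link of \<open>v\<close> is the contraction
  by \<open>x\<^sub>v\<close>.
\<close>

abbreviation lookup :: "('a \<Rightarrow>\<^sub>0 'b::zero) \<Rightarrow> 'a \<Rightarrow> 'b" where
  "lookup \<equiv> Poly_Mapping.lookup"

abbreviation keys :: "('a \<Rightarrow>\<^sub>0 'b::zero) \<Rightarrow> 'a set" where
  "keys \<equiv> Poly_Mapping.keys"

section \<open>Chains as functions\<close>

definition fsign :: "'v::{finite,linorder} \<Rightarrow> 'v set \<Rightarrow> 'k::field" where
  "fsign v \<tau> = (-1) ^ card {u\<in>\<tau>. u < v}"

text \<open>The coefficient at \<tau> of the simplicial boundary, collected from the cofaces of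
  \<tau>. Total functions can serve as chains because there are finitely many faces.\<close>

definition bd :: "('v::{finite,linorder} set \<Rightarrow> 'k::field) \<Rightarrow> 'v set \<Rightarrow> 'k" where
  "bd z \<tau> = (\<Sum>v\<in>-\<tau>. fsign v \<tau> * z (insert v \<tau>))"

lemma fsign_empty [simp]: "fsign v {} = 1"
  by (simp add: fsign_def)

lemma card_filter_insert:
  "finite \<tau> \<Longrightarrow> v \<notin> \<tau> \<Longrightarrow>
    card {u\<in>insert v \<tau>. P u} = (if P v then Suc (card {u\<in>\<tau>. P u}) else card {u\<in>\<tau>. P u})"
proof -
  assume "finite \<tau>" "v \<notin> \<tau>"
  moreover have "{u\<in>insert v \<tau>. P u} = (if P v then insert v {u\<in>\<tau>. P u} else {u\<in>\<tau>. P u})"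
    by auto
  ultimately show ?thesis by simp
qed

lemma fsign_insert:
  assumes "u \<notin> \<tau>"
  shows "fsign v (insert u \<tau>) = (if u < v then - fsign v \<tau> else fsign v \<tau>)"
  using assms unfolding fsign_def by (subst card_filter_insert) auto

text \<open>The smaller of the two vertices flips the sign of the larger one, and not conversely.
  This is the cancellation behind the vanishing of a double boundary.\<close>

lemma fsign_anticommute:
  assumes "u \<notin> \<tau>" "v \<notin> \<tau>" "u \<noteq> v"
  shows "fsign u \<tau> * fsign v (insert u \<tau>) = - (fsign v \<tau> * (fsign u (insert v \<tau>) :: 'k::field))"
  using assms by (auto simp: fsign_insert not_less_iff_gr_or_eq)

lemma bd_add: "bd (\<lambda>\<tau>. f \<tau> + g \<tau>) \<tau> = bd f \<tau> + bd g \<tau>"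
  by (simp add: bd_def sum.distrib algebra_simps)

lemma bd_sum: "bd (\<lambda>\<tau>. \<Sum>v\<in>A. f v \<tau>) \<tau> = (\<Sum>v\<in>A. bd (f v) \<tau>)"
  unfolding bd_def by (subst sum.swap) (simp add: sum_distrib_left)

text \<open>The part of \<open>z\<close> on faces through \<open>v\<close>, with \<open>v\<close>
  removed: a chain in the link of \<open>v\<close>. With this sign, \<open>bd z\<close> is the sum
  of the chains \<open>residual v z\<close> over all vertices \<open>v\<close>.\<close>

definition residual :: "'v::{finite,linorder} \<Rightarrow> ('v set \<Rightarrow> 'k::field) \<Rightarrow> 'v set \<Rightarrow> 'k" where
  "residual v z \<tau> = (if v \<in> \<tau> then 0 else fsign v \<tau> * z (insert v \<tau>))"

text \<open>Adding \<open>v\<close> and another vertex \<open>u\<close> in the two orders gives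
  opposite signs, and the term \<open>u = v\<close> vanishes. Consequently a cycle leaves a cycle in
  the link of each vertex.\<close>

lemma bd_residual: "bd (residual v z) \<tau> = - residual v (bd z) \<tau>"
proof (cases "v \<in> \<tau>")
  case True
  then show ?thesis by (simp add: bd_def residual_def)
next
  case False
  have "bd (residual v z) \<tau> = (\<Sum>u\<in>-\<tau>. fsign u \<tau> * residual v z (insert u \<tau>))"
    by (simp add: bd_def)
  also have "\<dots> = (\<Sum>u\<in>-insert v \<tau>. fsign u \<tau> * residual v z (insert u \<tau>))"
    by (rule sum.mono_neutral_right) (auto simp: residual_def)
  also have "\<dots> = (\<Sum>u\<in>-insert v \<tau>. - (fsign v \<tau> * (fsign u (insert v \<tau>) * z (insert u (insert v \<tau>)))))"
  proof (rule sum.cong[OF refl])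
    fix u assume "u \<in> - insert v \<tau>"
    then have u: "u \<notin> \<tau>" "u \<noteq> v" by auto
    have "fsign u \<tau> * residual v z (insert u \<tau>)
        = (fsign u \<tau> * fsign v (insert u \<tau>)) * z (insert u (insert v \<tau>))"
      using u False by (simp add: residual_def insert_commute)
    then show "fsign u \<tau> * residual v z (insert u \<tau>)
        = - (fsign v \<tau> * (fsign u (insert v \<tau>) * z (insert u (insert v \<tau>))))"
      using fsign_anticommute[OF u(1) False u(2), where 'k='a] by simp
  qed
  finally show ?thesis
    using False by (simp add: residual_def bd_def sum_negf sum_distrib_left)
qed

section \<open>Comparison with the simplicial boundary map\<close>

lemma lookup_boundary_map:
  "lookup (boundary_map c) \<tau> = bd (lookup c) (\<tau> :: 'v::{finite,linorder} set)"
proof -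
  have "lookup (boundary_map c) \<tau> = (\<Sum>\<sigma>\<in>keys c. \<Sum>v\<in>\<sigma>.
      ((-1) ^ card {u\<in>\<sigma>. u < v} * lookup c \<sigma> when \<sigma> - {v} = \<tau>))"
    by (simp add: boundary_map_def lookup_sum lookup_single)
  also have "\<dots> = (\<Sum>\<sigma>\<in>UNIV. \<Sum>v\<in>\<sigma>.
      ((-1) ^ card {u\<in>\<sigma>. u < v} * lookup c \<sigma> when \<sigma> - {v} = \<tau>))"
    by (rule sum.mono_neutral_left) (auto simp: in_keys_iff)
  also have "\<dots> = (\<Sum>(\<sigma>, v)\<in>Sigma UNIV (\<lambda>\<sigma>. \<sigma>).
      ((-1) ^ card {u\<in>\<sigma>. u < v} * lookup c \<sigma> when \<sigma> - {v} = \<tau>))"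
    by (rule sum.Sigma) auto
  \<comment> \<open>Only pairs with \<open>\<sigma> - {v} = \<tau>\<close> contribute, and these are
    parametrised by the vertices outside \<tau>.\<close>
  also have "\<dots> = (\<Sum>(\<sigma>, v)\<in>(\<lambda>v. (insert v \<tau>, v)) ` (-\<tau>).
      ((-1) ^ card {u\<in>\<sigma>. u < v} * lookup c \<sigma> when \<sigma> - {v} = \<tau>))"
    by (rule sum.mono_neutral_right) (auto simp: image_iff when_def)
  also have "\<dots> = (\<Sum>v\<in>-\<tau>. fsign v \<tau> * lookup c (insert v \<tau>))"
  proof (subst sum.reindex)
    show "inj_on (\<lambda>v. (insert v \<tau>, v)) (- \<tau>)" by (auto simp: inj_on_def)
    have "{u. (u = v \<or> u \<in> \<tau>) \<and> u < v} = {u\<in>\<tau>. u < v}" for v by auto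
    then show "sum ((\<lambda>(\<sigma>, v). ((-1) ^ card {u\<in>\<sigma>. u < v} * lookup c \<sigma> when \<sigma> - {v} = \<tau>))
        \<circ> (\<lambda>v. (insert v \<tau>, v))) (- \<tau>) = (\<Sum>v\<in>-\<tau>. fsign v \<tau> * lookup c (insert v \<tau>))"
      by (intro sum.cong) (auto simp: fsign_def)
  qed
  finally show ?thesis by (simp add: bd_def)
qed

lemma boundary_map_eq_0_iff: "boundary_map c = 0 \<longleftrightarrow> (\<forall>\<tau>. bd (lookup c) \<tau> = 0)"
  by (simp add: poly_mapping_eq_iff fun_eq_iff lookup_boundary_map)

lemma lookup_scale_chain: "lookup (scale_chain a c) = (\<lambda>\<tau>. a * lookup c \<tau>)"
  by (simp add: fun_eq_iff scale_chain_def map.rep_eq when_def)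

section \<open>Homology conditions in terms of coefficient functions\<close>

lemma chains_iff:
  "c \<in> chains K i \<longleftrightarrow> (\<forall>\<tau>. lookup c \<tau> \<noteq> 0 \<longrightarrow> \<tau> \<in> K \<and> face_dim \<tau> = i)"
  by (auto simp: chains_def in_keys_iff)

lemma zero_in_boundaries: "0 \<in> boundaries K i"
proof -
  have "boundary_map 0 = (0 :: 'a set \<Rightarrow>\<^sub>0 'b)" by (simp add: boundary_map_def)
  moreover have "0 \<in> chains K (i + 1)" by (simp add: chains_def)
  ultimately show ?thesis unfolding boundaries_def by (metis imageI)
qed

text \<open>There is only one coset; a cycle lies in its own coset, hence in that of 0, which
  consists of the boundaries.\<close>

lemma homology_zero_bounds:
  fixes K :: "'k::field itself" and z :: "'v::{finite,linorder} set \<Rightarrow> 'k"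
  assumes "homology_zero K \<Delta> i"
    and z: "\<And>\<tau>. z \<tau> \<noteq> 0 \<Longrightarrow> \<tau> \<in> \<Delta> \<and> face_dim \<tau> = i"
    and "\<And>\<tau>. bd z \<tau> = 0"
  obtains w :: "'v set \<Rightarrow> 'k" where "\<And>\<tau>. w \<tau> \<noteq> 0 \<Longrightarrow> \<tau> \<in> \<Delta> \<and> face_dim \<tau> = i + 1"
    and "\<And>\<tau>. bd w \<tau> = z \<tau>"
proof -
  define c where "c = Abs_poly_mapping z"
  have c: "lookup c = z" by (simp add: c_def)
  have "c \<in> cycles \<Delta> i"
    using assms(2,3) by (simp add: cycles_def chains_iff boundary_map_eq_0_iff c)
  then have "homology_class \<Delta> i c \<in> reduced_homology \<Delta> i" by (simp add: reduced_homology_def)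
  then have "homology_class \<Delta> i c = homology_class \<Delta> i 0"
    using assms(1) by (auto simp: homology_zero_def)
  moreover have "c \<in> homology_class \<Delta> i c"
    using zero_in_boundaries[of \<Delta> i, where 'b='k] by (force simp: homology_class_def)
  ultimately have "c \<in> boundaries \<Delta> i" by (auto simp: homology_class_def)
  then obtain e where e: "e \<in> chains \<Delta> (i + 1)" "c = boundary_map e"
    by (auto simp: boundaries_def)
  show thesis
  proof
    show "\<tau> \<in> \<Delta> \<and> face_dim \<tau> = i + 1" if "lookup e \<tau> \<noteq> 0" for \<tau>
      using e(1) that by (auto simp: chains_iff)
    show "bd (lookup e) \<tau> = z \<tau>" for \<tau>
      using e(2) c by (metis lookup_boundary_map)
  qed
qed

text \<open>Without chains in degree \<open>i + 1\<close> the only boundary is 0, so classes are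
  single cycles and \<open>h\<close> identifies the cycles themselves with the field. The cycle with
  value 1 spans.\<close>

lemma homology_field_top_cycles:
  fixes K :: "'k::field itself" and \<Delta> :: "'v::{finite,linorder} set set"
  assumes "homology_field K \<Delta> i"
    and top: "\<And>\<tau>. \<tau> \<in> \<Delta> \<Longrightarrow> face_dim \<tau> \<noteq> i + 1"
  obtains z\<^sub>0 :: "'v set \<Rightarrow> 'k" where "\<exists>\<tau>. z\<^sub>0 \<tau> \<noteq> 0"
    and "\<And>\<tau>. z\<^sub>0 \<tau> \<noteq> 0 \<Longrightarrow> \<tau> \<in> \<Delta> \<and> face_dim \<tau> = i" and "\<And>\<tau>. bd z\<^sub>0 \<tau> = 0"
    and "\<And>z :: 'v set \<Rightarrow> 'k. (\<And>\<tau>. z \<tau> \<noteq> 0 \<Longrightarrow> \<tau> \<in> \<Delta> \<and> face_dim \<tau> = i) \<Longrightarrow> (\<And>\<tau>. bd z \<tau> = 0)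
           \<Longrightarrow> \<exists>a. \<forall>\<tau>. z \<tau> = a * z\<^sub>0 \<tau>"
proof -
  let ?cl = "homology_class \<Delta> i :: ('v set \<Rightarrow>\<^sub>0 'k) \<Rightarrow> _"
  from assms(1) obtain h :: "('v set \<Rightarrow>\<^sub>0 'k) set \<Rightarrow> 'k" where
    h: "bij_betw h (reduced_homology \<Delta> i) UNIV"
       "\<And>a z. z \<in> cycles \<Delta> i \<Longrightarrow> h (?cl (scale_chain a z)) = a * h (?cl z)"
    by (auto simp: homology_field_def)
  have "chains \<Delta> (i + 1) = {0 :: 'v set \<Rightarrow>\<^sub>0 'k}"
  proof -
    have "c = 0" if "c \<in> chains \<Delta> (i + 1)" for c :: "'v set \<Rightarrow>\<^sub>0 'k"
      using that top by (intro poly_mapping_eqI) (auto simp: chains_iff)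
    moreover have "0 \<in> chains \<Delta> (i + 1)" by (simp add: chains_def)
    ultimately show ?thesis by blast
  qed
  then have "boundaries \<Delta> i = {0 :: 'v set \<Rightarrow>\<^sub>0 'k}"
    using zero_in_boundaries[of \<Delta> i, where 'b='k] by (auto simp: boundaries_def)
  then have cl: "?cl z = {z}" for z by (simp add: homology_class_def)
  have "1 \<in> h ` reduced_homology \<Delta> i" using h(1) by (simp add: bij_betw_def)
  then obtain c where c: "c \<in> cycles \<Delta> i" "h (?cl c) = 1"
    by (auto simp: reduced_homology_def)
  show thesis
  proof
    show "\<exists>\<tau>. lookup c \<tau> \<noteq> 0"
    proof (rule ccontr)
      assume "\<not> ?thesis"
      \<comment> \<open>A zero \<open>c\<close> equals its multiple by 0, so homogeneity of
        \<open>h\<close> would give the value 0 instead of 1.\<close>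
      then have "scale_chain 0 c = c"
        by (simp add: poly_mapping_eq_iff fun_eq_iff lookup_scale_chain)
      then show False using h(2)[OF c(1), of 0] c(2) by simp
    qed
    show "\<tau> \<in> \<Delta> \<and> face_dim \<tau> = i" if "lookup c \<tau> \<noteq> 0" for \<tau>
      using c(1) that by (auto simp: cycles_def chains_iff)
    show "bd (lookup c) \<tau> = 0" for \<tau>
      using c(1) by (simp add: cycles_def boundary_map_eq_0_iff)
    show "\<exists>a. \<forall>\<tau>. z \<tau> = a * lookup c \<tau>"
      if z: "\<And>\<tau>. z \<tau> \<noteq> 0 \<Longrightarrow> \<tau> \<in> \<Delta> \<and> face_dim \<tau> = i" "\<And>\<tau>. bd z \<tau> = 0" for z
    proof -
      define e where "e = Abs_poly_mapping z"
      have e: "lookup e = z" by (simp add: e_def)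
      have ec: "e \<in> cycles \<Delta> i"
        using z by (simp add: cycles_def chains_iff boundary_map_eq_0_iff e)
      define a where "a = h (?cl e)"
      have "bd (\<lambda>\<tau>. a * lookup c \<tau>) \<tau> = a * bd (lookup c) \<tau>" for \<tau>
        by (simp add: bd_def sum_distrib_left algebra_simps)
      then have "scale_chain a c \<in> cycles \<Delta> i"
        using c(1) by (auto simp: cycles_def chains_iff boundary_map_eq_0_iff lookup_scale_chain)
      moreover have "h (?cl (scale_chain a c)) = h (?cl e)" using h(2)[OF c(1)] c(2) a_def by simp
      ultimately have "?cl (scale_chain a c) = ?cl e"
        using ec h(1) by (auto simp: bij_betw_def inj_on_def reduced_homology_def)
      then have "e = scale_chain a c" by (simp add: cl)
      then have z_eq: "z = lookup (scale_chain a c)" using e by simp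
      show ?thesis unfolding z_eq lookup_scale_chain by blast
    qed
  qed
qed

section \<open>Chains graded by colours\<close>

text \<open>Passing from the vertex order to the colour order multiplies a face by this inversion sign.\<close>

definition inversion_sign :: "('v::{finite,linorder} \<Rightarrow> nat) \<Rightarrow> 'v set \<Rightarrow> 'k::field" where
  "inversion_sign \<rho> \<tau> = (-1) ^ card {(u, v). u \<in> \<tau> \<and> v \<in> \<tau> \<and> u < v \<and> \<rho> v < \<rho> u}"

lemma inversion_sign_nonzero [simp]: "inversion_sign \<rho> \<tau> \<noteq> (0 :: 'k::field)"
  by (simp add: inversion_sign_def)

text \<open>Adding \<open>v\<close> creates the inversions counted by \<open>?A\<close> and
  \<open>?C\<close>, while \<open>fsign\<close> counts \<open>?A\<close> and \<open>?B\<close>.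
  Modulo 2 the set \<open>?A\<close> cancels, and \<open>?B\<close> together with \<open>?C\<close>
  counts the colours below that of \<open>v\<close>.\<close>

lemma fsign_inversion_sign:
  fixes \<tau> :: "'v::{finite,linorder} set"
  assumes inj: "inj_on \<rho> (insert v \<tau>)" and v: "v \<notin> \<tau>"
  shows "fsign v \<tau> * inversion_sign \<rho> (insert v \<tau>)
       = inversion_sign \<rho> \<tau> * ((-1) ^ card {c\<in>\<rho> ` \<tau>. c < \<rho> v} :: 'k::field)"
proof -
  let ?I = "\<lambda>\<tau>. {(u, v). u \<in> \<tau> \<and> v \<in> \<tau> \<and> u < v \<and> \<rho> v < \<rho> u}"
  let ?A = "{u\<in>\<tau>. u < v \<and> \<rho> v < \<rho> u}" and ?B = "{u\<in>\<tau>. u < v \<and> \<rho> u < \<rho> v}"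
    and ?C = "{u\<in>\<tau>. v < u \<and> \<rho> u < \<rho> v}"
  have ne: "\<rho> u \<noteq> \<rho> v" "u \<noteq> v" if "u \<in> \<tau>" for u
    using inj v that by (auto simp: inj_on_def)
  have "?I (insert v \<tau>) = ?I \<tau> \<union> ((\<lambda>u. (u, v)) ` ?A \<union> (\<lambda>u. (v, u)) ` ?C)"
    by auto
  moreover have "card ((\<lambda>u. (u, v)) ` ?A \<union> (\<lambda>u. (v, u)) ` ?C)
      = card ((\<lambda>u. (u, v)) ` ?A) + card ((\<lambda>u. (v, u)) ` ?C)"
    using v by (intro card_Un_disjoint) auto
  moreover have "card (?I \<tau> \<union> ((\<lambda>u. (u, v)) ` ?A \<union> (\<lambda>u. (v, u)) ` ?C))
      = card (?I \<tau>) + card ((\<lambda>u. (u, v)) ` ?A \<union> (\<lambda>u. (v, u)) ` ?C)"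
    using v by (intro card_Un_disjoint) auto
  ultimately have "card (?I (insert v \<tau>))
      = card (?I \<tau>) + (card ((\<lambda>u. (u, v)) ` ?A) + card ((\<lambda>u. (v, u)) ` ?C))"
    by (simp only:)
  also have "card ((\<lambda>u. (u, v)) ` ?A) = card ?A" by (rule card_image) (auto simp: inj_on_def)
  also have "card ((\<lambda>u. (v, u)) ` ?C) = card ?C" by (rule card_image) (auto simp: inj_on_def)
  finally have 1: "card (?I (insert v \<tau>)) = card (?I \<tau>) + (card ?A + card ?C)" .
  have "{u\<in>\<tau>. u < v} = ?A \<union> ?B" using ne by (auto simp: not_less_iff_gr_or_eq)
  moreover have "card (?A \<union> ?B) = card ?A + card ?B" by (rule card_Un_disjoint) auto
  ultimately have 2: "card {u\<in>\<tau>. u < v} = card ?A + card ?B" by (simp only:)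
  have "{c\<in>\<rho> ` \<tau>. c < \<rho> v} = \<rho> ` (?B \<union> ?C)"
    using ne by (auto simp: not_less_iff_gr_or_eq image_iff)
  moreover have "inj_on \<rho> (?B \<union> ?C)" by (rule inj_on_subset[OF inj]) auto
  ultimately have "card {c\<in>\<rho> ` \<tau>. c < \<rho> v} = card (?B \<union> ?C)" by (simp only: card_image)
  also have "\<dots> = card ?B + card ?C" by (rule card_Un_disjoint) auto
  finally have 3: "card {c\<in>\<rho> ` \<tau>. c < \<rho> v} = card ?B + card ?C" .
  have "(-1) ^ card ?A * (-1) ^ card ?A = (1 :: 'k)" by (simp flip: power_mult_distrib)
  then show ?thesis
    unfolding fsign_def inversion_sign_def 1 2 3 by (simp add: power_add algebra_simps)
qed

text \<open>All nonzero terms at \<tau> add the same colour, the one of \<open>S\<close> missing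
  from \<tau>, and so carry a common sign. This turns unsigned balance conditions into the cycle
  condition.\<close>

lemma bd_inversion_sign:
  fixes c :: "'v::{finite,linorder} set \<Rightarrow> 'k::field"
  assumes supp: "\<And>\<tau>. c \<tau> \<noteq> 0 \<Longrightarrow> inj_on \<rho> \<tau> \<and> \<rho> ` \<tau> = S"
    and balance: "\<And>\<tau>. (\<Sum>v\<in>-\<tau>. c (insert v \<tau>)) = 0"
  shows "bd (\<lambda>\<tau>. inversion_sign \<rho> \<tau> * c \<tau>) \<tau> = 0"
proof (cases "\<exists>v\<in>-\<tau>. c (insert v \<tau>) \<noteq> 0")
  case False
  then show ?thesis by (auto simp: bd_def intro!: sum.neutral)
next
  case True
  then obtain w where w: "w \<notin> \<tau>" "c (insert w \<tau>) \<noteq> 0" by auto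
  have same: "\<rho> v = \<rho> w" if "v \<notin> \<tau>" "c (insert v \<tau>) \<noteq> 0" for v
  proof -
    have "inj_on \<rho> (insert v \<tau>)" "inj_on \<rho> (insert w \<tau>)"
      and "insert (\<rho> v) (\<rho> ` \<tau>) = S" "insert (\<rho> w) (\<rho> ` \<tau>) = S"
      using supp[OF w(2)] supp[OF that(2)] by auto
    then show ?thesis using w(1) that(1) by (auto simp: inj_on_def)
  qed
  let ?s = "inversion_sign \<rho> \<tau> * (-1) ^ card {c\<in>\<rho> ` \<tau>. c < \<rho> w} :: 'k"
  have "bd (\<lambda>\<tau>. inversion_sign \<rho> \<tau> * c \<tau>) \<tau> = (\<Sum>v\<in>-\<tau>. ?s * c (insert v \<tau>))"
    unfolding bd_def
  proof (rule sum.cong[OF refl])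
    fix v assume "v \<in> -\<tau>"
    then have v: "v \<notin> \<tau>" by simp
    show "fsign v \<tau> * (inversion_sign \<rho> (insert v \<tau>) * c (insert v \<tau>)) = ?s * c (insert v \<tau>)"
    proof (cases "c (insert v \<tau>) = 0")
      case False
      then have "fsign v \<tau> * inversion_sign \<rho> (insert v \<tau>) = ?s"
        using fsign_inversion_sign[OF _ v, of \<rho>] supp[OF False] same[OF v False] by simp
      then show ?thesis by (simp flip: mult.assoc)
    qed simp
  qed
  also have "\<dots> = ?s * (\<Sum>v\<in>-\<tau>. c (insert v \<tau>))" by (simp add: sum_distrib_left)
  finally show ?thesis by (simp add: balance)
qed

section \<open>Balanced homology spheres\<close>

text \<open>The diagonal is required to vanish separately, since in characteristic 2 antisymmetry
  does not force it.\<close>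

lemma sum_antisymmetric:
  fixes f :: "'a \<Rightarrow> 'a \<Rightarrow> 'k::ab_group_add"
  assumes "finite A" and "\<And>x. f x x = 0" and "\<And>x y. f x y = - f y x"
  shows "(\<Sum>x\<in>A. \<Sum>y\<in>A. f x y) = 0"
  using assms(1)
proof induction
  case (insert a A)
  have "(\<Sum>x\<in>A. f x a) = - (\<Sum>y\<in>A. f a y)"
    by (subst assms(3)) (simp add: sum_negf)
  then show ?case using insert assms(2) by (simp add: sum.distrib)
qed simp

text \<open>At the empty face the two coefficients cancel under the augmentation; at any other face
  the cofaces have at least two vertices, where the chain is 0.\<close>

lemma bd_point_difference:
  fixes v w :: "'v::{finite,linorder}"
  assumes "v \<noteq> w"
  shows "bd (\<lambda>\<tau>. if \<tau> = {v} then 1 else if \<tau> = {w} then -1 else 0) \<sigma> = (0 :: 'k::field)"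
    (is "bd ?z \<sigma> = 0")
proof (cases "\<sigma> = {}")
  case True
  have "bd ?z {} = (\<Sum>u\<in>UNIV. (if u = v then 1 else 0) + (if u = w then -1 else 0))"
    using assms by (auto simp: bd_def fsign_def intro!: sum.cong)
  then show ?thesis using True by (simp add: sum.distrib)
next
  case False
  then have "?z (insert u \<sigma>) = 0" if "u \<in> -\<sigma>" for u
    using that by auto
  then show ?thesis unfolding bd_def by (intro sum.neutral ballI) (simp only: mult_zero_right)
qed

locale balanced_homology_sphere =
  fixes K :: "'k::field itself"
    and \<Delta> :: "'v::{finite,linorder} set set"
    and d :: nat
    and \<rho> :: "'v \<Rightarrow> nat"
  assumes sphere: "homology_sphere K \<Delta>"
    and coloring: "balanced_coloring \<Delta> d \<rho>"
begin

lemma empty_face: "{} \<in> \<Delta>"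
  and face_subset: "\<sigma> \<in> \<Delta> \<Longrightarrow> \<tau> \<subseteq> \<sigma> \<Longrightarrow> \<tau> \<in> \<Delta>"
  using sphere by (auto simp: homology_sphere_def simplicial_complex_def)

lemma rainbow: "\<sigma> \<in> \<Delta> \<Longrightarrow> inj_on \<rho> \<sigma>"
proof (rule inj_onI, rule ccontr)
  fix u v assume "\<sigma> \<in> \<Delta>" "u \<in> \<sigma>" "v \<in> \<sigma>" "\<rho> u = \<rho> v" "u \<noteq> v"
  then show False
    using coloring face_subset[of \<sigma> "{u, v}"] by (auto simp: balanced_coloring_def)
qed

lemma color_range: "\<rho> v \<in> {1..d + 1}"
  using coloring by (auto simp: balanced_coloring_def)

lemma face_card_colors: "\<sigma> \<in> \<Delta> \<Longrightarrow> card (\<rho> ` \<sigma>) = card \<sigma>"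
  by (simp add: card_image rainbow)

lemma dim_eq: "complex_dim \<Delta> = int d"
  using coloring by (simp add: balanced_coloring_def)

lemma face_card_le: "\<sigma> \<in> \<Delta> \<Longrightarrow> card \<sigma> \<le> d + 1"
proof -
  assume "\<sigma> \<in> \<Delta>"
  then have "face_dim \<sigma> \<le> complex_dim \<Delta>" unfolding complex_dim_def by (intro Max_ge) auto
  then show ?thesis by (simp add: dim_eq face_dim_def)
qed

lemma ex_top_face: "\<exists>\<sigma>\<in>\<Delta>. card \<sigma> = d + 1"
proof -
  have "complex_dim \<Delta> \<in> face_dim ` \<Delta>" unfolding complex_dim_def
    using empty_face by (intro Max_in) auto
  then obtain \<sigma> where "\<sigma> \<in> \<Delta>" "int d = face_dim \<sigma>" by (auto simp: dim_eq)
  then show ?thesis by (intro bexI[of _ \<sigma>]) (auto simp: face_dim_def)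
qed

lemma mem_link: "\<tau> \<in> link \<Delta> \<sigma> \<longleftrightarrow> \<tau> \<union> \<sigma> \<in> \<Delta> \<and> \<tau> \<inter> \<sigma> = {}"
  using face_subset by (auto simp: link_def)

section \<open>Connected links and purity\<close>

lemma facet_above: "\<sigma> \<in> \<Delta> \<Longrightarrow> \<exists>G\<in>facets \<Delta>. \<sigma> \<subseteq> G"
  using finite_has_maximal2[of \<Delta> \<sigma>] by (auto simp: facets_def)

text \<open>If no edge left \<open>A\<close>, the difference of the points \<open>v\<close> and
  \<open>w\<close> would bound a chain of edges that do not cross. Summing the boundary over
  \<open>A\<close> then counts each inner edge twice with opposite signs and gives 0, whereas the
  point \<open>v\<close> alone contributes 1.\<close>

lemma link_connected:
  fixes A :: "'v set"
  assumes zero: "homology_zero K (link \<Delta> \<sigma>) 0"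
    and v: "{v} \<in> link \<Delta> \<sigma>" "v \<in> A" and w: "{w} \<in> link \<Delta> \<sigma>" "w \<notin> A"
  shows "\<exists>x\<in>A. \<exists>y. y \<notin> A \<and> {x, y} \<in> link \<Delta> \<sigma>"
proof (rule ccontr)
  assume "\<not> ?thesis"
  then have no_edge: "{x, y} \<notin> link \<Delta> \<sigma>" if "x \<in> A" "y \<notin> A" for x y
    using that by blast
  have vw: "v \<noteq> w" using v w by auto
  define z :: "'v set \<Rightarrow> 'k" where
    "z \<tau> = (if \<tau> = {v} then 1 else if \<tau> = {w} then -1 else 0)" for \<tau>
  have "bd z \<tau> = 0" for \<tau>
    unfolding z_def using vw by (rule bd_point_difference)
  moreover have "\<tau> \<in> link \<Delta> \<sigma> \<and> face_dim \<tau> = 0" if "z \<tau> \<noteq> 0" for \<tau>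
    using that v w by (auto simp: z_def face_dim_def split: if_splits)
  ultimately obtain e :: "'v set \<Rightarrow> 'k" where
    e: "\<And>\<tau>. e \<tau> \<noteq> 0 \<Longrightarrow> \<tau> \<in> link \<Delta> \<sigma> \<and> face_dim \<tau> = 0 + 1" "\<And>\<tau>. bd e \<tau> = z \<tau>"
    using homology_zero_bounds[OF zero] by blast
  \<comment> \<open>\<open>f u x\<close> is the contribution of the edge from \<open>u\<close> to
    \<open>x\<close> to the boundary coefficient at \<open>u\<close>.\<close>
  define f where "f u x = (if u = x then 0 else fsign x {u} * e {u, x})" for u x
  have "(\<Sum>u\<in>A. bd e {u}) = (\<Sum>u\<in>A. \<Sum>x\<in>A. f u x)"
  proof (rule sum.cong[OF refl])
    fix u assume u: "u \<in> A"
    have "bd e {u} = (\<Sum>x\<in>-{u}. f u x)"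
      by (auto simp: bd_def f_def insert_commute intro!: sum.cong)
    also have "\<dots> = (\<Sum>x\<in>A - {u}. f u x)"
      using no_edge[OF u] e(1) by (intro sum.mono_neutral_right) (auto simp: f_def)
    also have "\<dots> = (\<Sum>x\<in>A. f u x)"
      by (rule sum.mono_neutral_left) (auto simp: f_def)
    finally show "bd e {u} = (\<Sum>x\<in>A. f u x)" .
  qed
  also have "\<dots> = 0"
  proof (rule sum_antisymmetric)
    have "fsign x {u} = (if u < x then -1 else 1 :: 'k)" for u x :: 'v
      by (simp add: fsign_insert)
    then show "f u x = - f x u" for u x
      by (cases u x rule: linorder_cases) (auto simp: f_def insert_commute)
  qed (auto simp: f_def)
  finally have "(\<Sum>u\<in>A. z {u}) = 0" using e(2) by simp
  moreover have "(\<Sum>u\<in>A. z {u}) = (\<Sum>u\<in>A. if u = v then 1 else 0)"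
    using w by (intro sum.cong) (auto simp: z_def)
  ultimately show False using v by simp
qed

text \<open>Purity: the size of a facet through a vertex of a link is, by induction, constant along
  the edges of the link, hence constant because the link is connected.\<close>

lemma facets_above_same_card:
  assumes "\<sigma> \<in> \<Delta>" "G \<in> facets \<Delta>" "\<sigma> \<subseteq> G" "H \<in> facets \<Delta>" "\<sigma> \<subseteq> H"
  shows "card G = card H"
  using assms
proof (induction "d + 1 - card \<sigma>" arbitrary: \<sigma> G H rule: less_induct)
  case less
  have G: "G \<in> \<Delta>" and H: "H \<in> \<Delta>" using less.prems by (auto simp: facets_def)
  have IH: "card G' = card H'"
    if "u \<notin> \<sigma>" "insert u \<sigma> \<in> \<Delta>" "G' \<in> facets \<Delta>" "insert u \<sigma> \<subseteq> G'" "H' \<in> facets \<Delta>" "insert u \<sigma> \<subseteq> H'"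
    for u G' H'
  proof (rule less.hyps[OF _ that(2-)])
    show "d + 1 - card (insert u \<sigma>) < d + 1 - card \<sigma>"
      using face_card_le[OF that(2)] that(1) by simp
  qed
  show ?case
  proof (cases "\<sigma> = G \<or> \<sigma> = H")
    case True
    then show ?thesis using less.prems by (auto simp: facets_def)
  next
    case False
    then obtain v w where v: "v \<in> G" "v \<notin> \<sigma>" and w: "w \<in> H" "w \<notin> \<sigma>"
      using less.prems by blast
    have linkG: "G - \<sigma> \<in> link \<Delta> \<sigma>" and linkH: "H - \<sigma> \<in> link \<Delta> \<sigma>"
      using less.prems G H by (auto simp: mem_link Un_absorb2)
    \<comment> \<open>A link of dimension 0 may be disconnected, but there every facet above
      \<sigma> has exactly one more vertex than \<sigma>. In any other dimension the reduced
      homology in degree 0 vanishes.\<close>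
    show ?thesis
    proof (cases "complex_dim (link \<Delta> \<sigma>) = 0")
      case True
      have "card (F - \<sigma>) = 1" if "F - \<sigma> \<in> link \<Delta> \<sigma>" "u \<in> F - \<sigma>" for F u
      proof -
        have "face_dim (F - \<sigma>) \<le> complex_dim (link \<Delta> \<sigma>)"
          unfolding complex_dim_def using that by (intro Max_ge) auto
        moreover have "card (F - \<sigma>) > 0" using that by (auto simp: card_gt_0_iff)
        ultimately show ?thesis using True by (simp add: face_dim_def)
      qed
      then have "card (G - \<sigma>) = card (H - \<sigma>)" using linkG linkH v w by auto
      moreover have "card G = card (G - \<sigma>) + card \<sigma>" "card H = card (H - \<sigma>) + card \<sigma>"
        using less.prems by (simp_all add: card_Diff_subset card_mono)
      ultimately show ?thesis by simp
    next
      case False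
      then have zero: "homology_zero K (link \<Delta> \<sigma>) 0"
        using sphere less.prems(1) by (auto simp: homology_sphere_def)
      \<comment> \<open>This set contains \<open>v\<close> and not \<open>w\<close>. The edge
        leaving it lies in a facet which, by induction at its end in \<open>A\<close>, has the size
        of \<open>G\<close>; that puts the other end in \<open>A\<close> too.\<close>
      define A where "A = {u. \<exists>F\<in>facets \<Delta>. insert u \<sigma> \<subseteq> F \<and> card F = card G}"
      show ?thesis
      proof (rule ccontr)
        assume ne: "card G \<noteq> card H"
        have "insert v \<sigma> \<subseteq> G" "insert w \<sigma> \<subseteq> H" using less.prems v w by auto
        then have vw: "insert v \<sigma> \<in> \<Delta>" "insert w \<sigma> \<in> \<Delta>" using face_subset G H by blast+
        have "v \<in> A" using \<open>insert v \<sigma> \<subseteq> G\<close> less.prems by (auto simp: A_def)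
        moreover have "w \<notin> A"
          using IH[OF w(2) vw(2) _ _ less.prems(4) \<open>insert w \<sigma> \<subseteq> H\<close>] ne by (auto simp: A_def)
        moreover have "{v} \<in> link \<Delta> \<sigma>" "{w} \<in> link \<Delta> \<sigma>" using vw v w by (auto simp: mem_link)
        ultimately obtain x y where xy: "x \<in> A" "y \<notin> A" "{x, y} \<in> link \<Delta> \<sigma>"
          using link_connected[OF zero] by blast
        from xy(3) have \<sigma>xy: "insert x (insert y \<sigma>) \<in> \<Delta>" "x \<notin> \<sigma>" by (auto simp: mem_link)
        then obtain F where F: "F \<in> facets \<Delta>" "insert x (insert y \<sigma>) \<subseteq> F"
          using facet_above by blast
        obtain F' where F': "F' \<in> facets \<Delta>" "insert x \<sigma> \<subseteq> F'" "card F' = card G"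
          using xy(1) by (auto simp: A_def)
        have "card F = card F'"
          using IH[OF \<sigma>xy(2) face_subset[OF \<sigma>xy(1)] F(1) _ F'(1,2)] F(2) by auto
        then have "y \<in> A" using F F' by (auto simp: A_def)
        then show False using xy by simp
      qed
    qed
  qed
qed

text \<open>Purity above the empty face compares every facet with one that contains a face of top
  dimension.\<close>

lemma facets_iff: "\<sigma> \<in> facets \<Delta> \<longleftrightarrow> \<sigma> \<in> \<Delta> \<and> card \<sigma> = d + 1"
proof
  assume \<sigma>: "\<sigma> \<in> \<Delta> \<and> card \<sigma> = d + 1"
  have "\<tau> = \<sigma>" if "\<tau> \<in> \<Delta>" "\<sigma> \<subseteq> \<tau>" for \<tau>
    using card_seteq[of \<tau> \<sigma>] face_card_le[OF that(1)] that(2) \<sigma> by simp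
  then show "\<sigma> \<in> facets \<Delta>" using \<sigma> by (auto simp: facets_def)
next
  assume \<sigma>: "\<sigma> \<in> facets \<Delta>"
  obtain \<tau> where \<tau>: "\<tau> \<in> \<Delta>" "card \<tau> = d + 1" using ex_top_face by blast
  obtain G where G: "G \<in> facets \<Delta>" "\<tau> \<subseteq> G" using facet_above[OF \<tau>(1)] by blast
  have "d + 1 \<le> card G" using \<tau>(2) card_mono[OF _ G(2)] by simp
  moreover have "card G \<le> d + 1" using G face_card_le by (auto simp: facets_def)
  moreover have "card \<sigma> = card G" using facets_above_same_card[OF empty_face \<sigma> _ G(1)] by simp
  ultimately show "\<sigma> \<in> \<Delta> \<and> card \<sigma> = d + 1" using \<sigma> by (auto simp: facets_def)
qed

lemma facet_colors: "\<sigma> \<in> facets \<Delta> \<Longrightarrow> \<rho> ` \<sigma> = {1..d + 1}"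
  using face_card_colors color_range by (intro card_subset_eq) (auto simp: facets_iff)

section \<open>Top cycles of links\<close>

lemma link_dim:
  assumes "\<sigma> \<in> \<Delta>"
  shows "complex_dim (link \<Delta> \<sigma>) = int d - int (card \<sigma>)"
proof -
  obtain G where G: "G \<in> facets \<Delta>" "\<sigma> \<subseteq> G" using facet_above assms by blast
  have "face_dim (G - \<sigma>) = int d - int (card \<sigma>)"
    using G face_card_le[OF assms] by (auto simp: facets_iff face_dim_def card_Diff_subset)
  moreover have "G - \<sigma> \<in> link \<Delta> \<sigma>" using G by (auto simp: mem_link facets_iff Un_absorb2)
  moreover have "face_dim \<tau> \<le> int d - int (card \<sigma>)" if "\<tau> \<in> link \<Delta> \<sigma>" for \<tau>
    using face_card_le[of "\<tau> \<union> \<sigma>"] that by (auto simp: mem_link face_dim_def card_Un_disjoint)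
  ultimately show ?thesis
    unfolding complex_dim_def by (intro Max_eqI) force+
qed

lemma link_homology_zero:
  "\<sigma> \<in> \<Delta> \<Longrightarrow> i \<noteq> int d - int (card \<sigma>) \<Longrightarrow> homology_zero K (link \<Delta> \<sigma>) i"
  using sphere by (auto simp: homology_sphere_def link_dim)

lemma link_homology_field:
  "\<sigma> \<in> \<Delta> \<Longrightarrow> homology_field K (link \<Delta> \<sigma>) (int d - int (card \<sigma>))"
  using sphere by (auto simp: homology_sphere_def link_dim)

text \<open>The top faces of the link of \<sigma> are the sets that complete \<sigma> to a facet,
  and no face of the link is larger, so the top homology is the space of cycles itself.\<close>

lemma link_top_cycles:
  assumes "\<sigma> \<in> \<Delta>"
  shows "\<exists>z\<^sub>0 :: 'v set \<Rightarrow> 'k. (\<exists>\<tau>. z\<^sub>0 \<tau> \<noteq> 0) \<and>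
    (\<forall>\<tau>. z\<^sub>0 \<tau> \<noteq> 0 \<longrightarrow> \<tau> \<inter> \<sigma> = {} \<and> \<tau> \<union> \<sigma> \<in> facets \<Delta>) \<and> (\<forall>\<tau>. bd z\<^sub>0 \<tau> = 0) \<and>
    (\<forall>z :: 'v set \<Rightarrow> 'k. (\<forall>\<tau>. z \<tau> \<noteq> 0 \<longrightarrow> \<tau> \<inter> \<sigma> = {} \<and> \<tau> \<union> \<sigma> \<in> facets \<Delta>) \<longrightarrow>
      (\<forall>\<tau>. bd z \<tau> = 0) \<longrightarrow> (\<exists>a. \<forall>\<tau>. z \<tau> = a * z\<^sub>0 \<tau>))"
proof -
  have top: "(\<tau> \<in> link \<Delta> \<sigma> \<and> face_dim \<tau> = int d - int (card \<sigma>))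
      \<longleftrightarrow> \<tau> \<inter> \<sigma> = {} \<and> \<tau> \<union> \<sigma> \<in> facets \<Delta>" for \<tau>
    by (auto simp: mem_link facets_iff face_dim_def card_Un_disjoint)
  have no_higher: "face_dim \<tau> \<noteq> int d - int (card \<sigma>) + 1" if "\<tau> \<in> link \<Delta> \<sigma>" for \<tau>
    using face_card_le[of "\<tau> \<union> \<sigma>"] that by (auto simp: mem_link face_dim_def card_Un_disjoint)
  obtain z\<^sub>0 :: "'v set \<Rightarrow> 'k" where "\<exists>\<tau>. z\<^sub>0 \<tau> \<noteq> 0"
    and "\<And>\<tau>. z\<^sub>0 \<tau> \<noteq> 0 \<Longrightarrow> \<tau> \<in> link \<Delta> \<sigma> \<and> face_dim \<tau> = int d - int (card \<sigma>)" and "\<And>\<tau>. bd z\<^sub>0 \<tau> = 0"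
    and "\<And>z :: 'v set \<Rightarrow> 'k. (\<And>\<tau>. z \<tau> \<noteq> 0 \<Longrightarrow> \<tau> \<in> link \<Delta> \<sigma> \<and> face_dim \<tau> = int d - int (card \<sigma>))
           \<Longrightarrow> (\<And>\<tau>. bd z \<tau> = 0) \<Longrightarrow> \<exists>a. \<forall>\<tau>. z \<tau> = a * z\<^sub>0 \<tau>"
    by (rule homology_field_top_cycles[OF link_homology_field[OF assms] no_higher]) blast+
  then show ?thesis unfolding top by (intro exI[of _ z\<^sub>0]) blast
qed

text \<open>The link of a ridge is a set of points whose degree 0 cycles form a line. A nonzero
  cycle has coefficient sum 0 and hence at least two points \<open>p\<close> and \<open>q\<close>; a
  third point \<open>r\<close> would give the cycle \<open>p\<close> minus \<open>r\<close>, which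
  vanishes at \<open>q\<close> and is no multiple of the first.\<close>

lemma ridge_in_two_facets:
  assumes "\<tau> \<in> \<Delta>" "card \<tau> = d"
  obtains p q where "p \<noteq> q" "{v\<in>-\<tau>. insert v \<tau> \<in> facets \<Delta>} = {p, q}"
proof -
  let ?V = "{v\<in>-\<tau>. insert v \<tau> \<in> facets \<Delta>}"
  obtain z\<^sub>0 :: "'v set \<Rightarrow> 'k" where ne: "\<exists>\<sigma>. z\<^sub>0 \<sigma> \<noteq> 0"
    and supp: "\<And>\<sigma>. z\<^sub>0 \<sigma> \<noteq> 0 \<Longrightarrow> \<sigma> \<inter> \<tau> = {} \<and> \<sigma> \<union> \<tau> \<in> facets \<Delta>" and cyc: "\<And>\<sigma>. bd z\<^sub>0 \<sigma> = 0"
    and gen: "\<And>z :: 'v set \<Rightarrow> 'k. (\<And>\<sigma>. z \<sigma> \<noteq> 0 \<Longrightarrow> \<sigma> \<inter> \<tau> = {} \<and> \<sigma> \<union> \<tau> \<in> facets \<Delta>)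
           \<Longrightarrow> (\<And>\<sigma>. bd z \<sigma> = 0) \<Longrightarrow> \<exists>a. \<forall>\<sigma>. z \<sigma> = a * z\<^sub>0 \<sigma>"
    using link_top_cycles[OF assms(1)] by blast
  have single: "\<exists>v\<in>?V. \<sigma> = {v}" if "z\<^sub>0 \<sigma> \<noteq> 0" for \<sigma>
  proof -
    have \<sigma>: "\<sigma> \<inter> \<tau> = {}" "\<sigma> \<union> \<tau> \<in> facets \<Delta>" using supp that by auto
    then have "card \<sigma> = 1" using assms(2) by (auto simp: facets_iff card_Un_disjoint)
    then show ?thesis using \<sigma> by (auto simp: card_1_singleton_iff)
  qed
  have sum0: "(\<Sum>v\<in>UNIV. z\<^sub>0 {v}) = 0"
    using cyc[of "{}"] by (simp add: bd_def fsign_def)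
  obtain p where p: "p \<in> ?V" "z\<^sub>0 {p} \<noteq> 0" using ne single by blast
  obtain q where q: "q \<noteq> p" "z\<^sub>0 {q} \<noteq> 0"
  proof -
    have "\<exists>q. q \<noteq> p \<and> z\<^sub>0 {q} \<noteq> 0"
    proof (rule ccontr)
      assume "\<not> ?thesis"
      then have "(\<Sum>v\<in>UNIV. z\<^sub>0 {v}) = (\<Sum>v\<in>{p}. z\<^sub>0 {v})"
        by (intro sum.mono_neutral_right) auto
      then show False using sum0 p by simp
    qed
    then show thesis using that by blast
  qed
  have "q \<in> ?V" using single[OF q(2)] by auto
  moreover have "r = p \<or> r = q" if "r \<in> ?V" for r
  proof (rule ccontr)
    assume r: "\<not> ?thesis"
    define z :: "'v set \<Rightarrow> 'k" where
      "z \<sigma> = (if \<sigma> = {p} then 1 else if \<sigma> = {r} then -1 else 0)" for \<sigma>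
    have "bd z \<sigma> = 0" for \<sigma>
      unfolding z_def using r by (intro bd_point_difference) auto
    moreover have "\<sigma> \<inter> \<tau> = {} \<and> \<sigma> \<union> \<tau> \<in> facets \<Delta>" if "z \<sigma> \<noteq> 0" for \<sigma>
    proof -
      have "\<sigma> = {p} \<or> \<sigma> = {r}" using that by (auto simp: z_def split: if_splits)
      then show ?thesis using p(1) \<open>r \<in> ?V\<close> by auto
    qed
    ultimately obtain a where a: "\<And>\<sigma>. z \<sigma> = a * z\<^sub>0 \<sigma>"
      using gen[of z] by blast
    have "z {p} = 1" "z {q} = 0" using q r by (auto simp: z_def)
    then show False using a[of "{p}"] a[of "{q}"] q p by auto
  qed
  ultimately show thesis using that[of p q] p q by blast
qed

section \<open>Colour selection\<close>

text \<open>The faces with \<open>m\<close> vertices, hence of dimension \<open>m - 1\<close>, of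
  the colour-selected link. When \<sigma> is not a face the set is empty, which lets the inductions
  add vertices to \<sigma> without checking that a face results.\<close>

definition colored_link :: "'v set \<Rightarrow> nat set \<Rightarrow> nat \<Rightarrow> 'v set set" where
  "colored_link \<sigma> S m = {\<tau>. \<tau> \<union> \<sigma> \<in> \<Delta> \<and> \<tau> \<inter> \<sigma> = {} \<and> \<rho> ` \<tau> \<subseteq> S \<and> card \<tau> = m}"

text \<open>Vertices of a face have distinct colours, so removing \<open>v\<close> removes the
  colour \<open>i\<close>.\<close>

lemma colored_link_residual:
  assumes "\<rho> v = i" "insert v \<tau> \<in> colored_link \<sigma> (insert i S) (Suc m)" "v \<notin> \<tau>"
  shows "\<tau> \<in> colored_link (insert v \<sigma>) S m"
proof -
  have "inj_on \<rho> (insert v \<tau>)"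
    using rainbow[of "insert v \<tau> \<union> \<sigma>"] assms(2) by (auto simp: colored_link_def intro: inj_on_subset)
  then have "\<rho> u \<noteq> i" if "u \<in> \<tau>" for u
    using that assms(1,3) by (auto simp: inj_on_def)
  then show ?thesis using assms by (auto simp: colored_link_def)
qed

lemma colored_link_mono:
  assumes "v \<notin> \<tau>" "\<tau> \<in> colored_link (insert v \<sigma>) S m"
  shows "\<tau> \<in> colored_link \<sigma> S m"
  using assms face_subset[of "\<tau> \<union> insert v \<sigma>" "\<tau> \<union> \<sigma>"] by (auto simp: colored_link_def)

text \<open>Deleting the vertices of colour \<open>i\<close> from a colour-selected complex removes the open stars of
  these vertices, so a chain bounding \<open>z\<close> splits into a chain avoiding \<open>i\<close> and cones over cycles
  in the links of the vertices of colour \<open>i\<close>.\<close>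

lemma color_deletion:
  fixes z w :: "'v set \<Rightarrow> 'k"
  assumes i: "i \<notin> S"
    and w: "\<And>\<tau>. w \<tau> \<noteq> 0 \<Longrightarrow> \<tau> \<in> colored_link \<sigma> (insert i S) (Suc m)"
    and z: "\<And>\<tau>. z \<tau> \<noteq> 0 \<Longrightarrow> \<tau> \<in> colored_link \<sigma> S m"
    and bd: "\<And>\<tau>. bd w \<tau> = z \<tau>"
  shows "\<rho> v = i \<Longrightarrow> residual v w \<tau> \<noteq> 0 \<Longrightarrow> \<tau> \<in> colored_link (insert v \<sigma>) S m"
    and "\<rho> v = i \<Longrightarrow> bd (residual v w) \<tau> = 0"
    and "z \<tau> = bd (\<lambda>\<tau>. if \<rho> ` \<tau> \<subseteq> S then w \<tau> else 0) \<tau> + (\<Sum>v | \<rho> v = i. residual v w \<tau>)"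
proof -
  show res: "\<tau> \<in> colored_link (insert v \<sigma>) S m" if "\<rho> v = i" "residual v w \<tau> \<noteq> 0" for v \<tau>
    using that w[of "insert v \<tau>"] by (intro colored_link_residual) (auto simp: residual_def split: if_splits)
  show "bd (residual v w) \<tau> = 0" if "\<rho> v = i"
  proof -
    \<comment> \<open>The colour \<open>i\<close> does not occur in \<open>z\<close>, so the
      residual of \<open>z\<close> at \<open>v\<close> is 0; up to sign it is the boundary of the
      residual of \<open>w\<close>.\<close>
    have "z (insert v \<tau>) = 0" using z[of "insert v \<tau>"] i that by (auto simp: colored_link_def)
    moreover have "bd w = z" using bd by (simp add: fun_eq_iff)
    ultimately show ?thesis by (simp add: bd_residual residual_def)
  qed
  let ?w = "\<lambda>\<tau>. if \<rho> ` \<tau> \<subseteq> S then w \<tau> else 0"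
  show "z \<tau> = bd ?w \<tau> + (\<Sum>v | \<rho> v = i. residual v w \<tau>)"
  proof (cases "\<rho> ` \<tau> \<subseteq> S")
    case True
    \<comment> \<open>An added vertex with colour in \<open>S\<close> contributes to the truncated
      chain, one with colour \<open>i\<close> to its residual.\<close>
    have "bd w \<tau> = (\<Sum>v\<in>-\<tau>. fsign v \<tau> * ?w (insert v \<tau>) + (if \<rho> v = i then residual v w \<tau> else 0))"
      unfolding bd_def
    proof (rule sum.cong[OF refl])
      fix v assume "v \<in> - \<tau>"
      moreover have "\<rho> v \<in> insert i S" if "w (insert v \<tau>) \<noteq> 0"
        using w[OF that] by (auto simp: colored_link_def)
      ultimately show "fsign v \<tau> * w (insert v \<tau>)
          = fsign v \<tau> * ?w (insert v \<tau>) + (if \<rho> v = i then residual v w \<tau> else 0)"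
        using True i by (cases "w (insert v \<tau>) = 0") (auto simp: residual_def)
    qed
    also have "\<dots> = bd ?w \<tau> + (\<Sum>v\<in>-\<tau>. if \<rho> v = i then residual v w \<tau> else 0)"
      by (simp only: sum.distrib bd_def)
    also have "(\<Sum>v\<in>-\<tau>. if \<rho> v = i then residual v w \<tau> else 0) = (\<Sum>v\<in>UNIV. if \<rho> v = i then residual v w \<tau> else 0)"
      by (rule sum.mono_neutral_left) (auto simp: residual_def)
    also have "\<dots> = (\<Sum>v | \<rho> v = i. residual v w \<tau>)"
      by (simp add: sum.If_cases)
    finally show ?thesis by (simp add: bd)
  next
    case False
    have "residual v w \<tau> = 0" if "\<rho> v = i" for v
      using res[OF that, of \<tau>] False by (auto simp: colored_link_def)
    moreover have "\<not> \<rho> ` insert v \<tau> \<subseteq> S" for v using False by auto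
    then have "bd ?w \<tau> = 0" unfolding bd_def by (intro sum.neutral) auto
    moreover have "z \<tau> = 0" using z[of \<tau>] False by (auto simp: colored_link_def)
    ultimately show ?thesis by simp
  qed
qed

text \<open>By counting, \<open>S\<close> is the complement of the colours of \<sigma>, and a face
  disjoint from \<sigma> in its link avoids those colours. Colour selection is then no restriction,
  which gives the base case of the inductions.\<close>

lemma colored_link_all_colors:
  assumes S: "S \<subseteq> {1..d + 1}" "S \<inter> \<rho> ` \<sigma> = {}" "card S + card \<sigma> = d + 1" and "\<sigma> \<in> \<Delta>"
    and "\<tau> \<union> \<sigma> \<in> \<Delta>" "\<tau> \<inter> \<sigma> = {}"
  shows "\<rho> ` \<tau> \<subseteq> S"
proof -
  have fin: "finite S" using S(1) finite_subset by blast
  have "card (S \<union> \<rho> ` \<sigma>) = card S + card \<sigma>"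
    using S(2) fin face_card_colors[OF \<open>\<sigma> \<in> \<Delta>\<close>] by (simp add: card_Un_disjoint)
  then have "S \<union> \<rho> ` \<sigma> = {1..d + 1}"
    using S(1,3) color_range by (intro card_subset_eq) (simp_all only: Un_subset_iff image_subset_iff card_atLeastAtMost finite_atLeastAtMost, simp_all)
  then have "\<rho> u \<in> S \<union> \<rho> ` \<sigma>" for u using color_range[of u] by (simp only:)
  moreover have "\<rho> u \<notin> \<rho> ` \<sigma>" if "u \<in> \<tau>" for u
    using rainbow[OF assms(5)] that assms(6) by (auto simp: inj_on_def)
  ultimately show ?thesis by blast
qed

lemma missing_color:
  assumes "S \<subseteq> {1..d + 1}" "card S + card \<sigma> + Suc n = d + 1"
  obtains i where "i \<in> {1..d + 1}" "i \<notin> S" "i \<notin> \<rho> ` \<sigma>"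
proof -
  have "\<not> {1..d + 1} \<subseteq> S \<union> \<rho> ` \<sigma>"
  proof
    assume "{1..d + 1} \<subseteq> S \<union> \<rho> ` \<sigma>"
    moreover have "finite (S \<union> \<rho> ` \<sigma>)" using finite_subset[OF assms(1)] by simp
    ultimately have "card {1..d + 1} \<le> card (S \<union> \<rho> ` \<sigma>)" by (rule card_mono[rotated])
    also have "\<dots> \<le> card S + card (\<rho> ` \<sigma>)" by (rule card_Un_le)
    also have "\<dots> \<le> card S + card \<sigma>" by (simp add: card_image_le)
    finally show False using assms(2) by simp
  qed
  then show thesis using that by blast
qed

lemma color_selected_acyclic:
  fixes z :: "'v set \<Rightarrow> 'k"
  assumes "S \<subseteq> {1..d + 1}" "S \<inter> \<rho> ` \<sigma> = {}" "card S + card \<sigma> + n = d + 1" "m < card S"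
    and "\<And>\<tau>. z \<tau> \<noteq> 0 \<Longrightarrow> \<tau> \<in> colored_link \<sigma> S m" and "\<And>\<tau>. bd z \<tau> = 0"
  shows "\<exists>w. (\<forall>\<tau>. w \<tau> \<noteq> 0 \<longrightarrow> \<tau> \<in> colored_link \<sigma> S (Suc m)) \<and> (\<forall>\<tau>. bd w \<tau> = z \<tau>)"
  using assms
proof (induction n arbitrary: \<sigma> S z)
  case 0
  show ?case
  proof (cases "\<sigma> \<in> \<Delta>")
    case False
    then have "z \<tau> = 0" for \<tau>
      using 0(5)[of \<tau>] face_subset[of "\<tau> \<union> \<sigma>" \<sigma>] by (auto simp: colored_link_def)
    then show ?thesis by (intro exI[of _ "\<lambda>_. 0"]) (simp add: bd_def)
  next
    case True
    have eq: "\<tau> \<in> link \<Delta> \<sigma> \<and> face_dim \<tau> = int k - 1 \<longleftrightarrow> \<tau> \<in> colored_link \<sigma> S k" for \<tau> k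
      using colored_link_all_colors[of S \<sigma> \<tau>] 0(1-3) True
      by (auto simp: colored_link_def mem_link face_dim_def)
    \<comment> \<open>The link has dimension \<open>card S - 1\<close> here, so
      \<open>m < card S\<close> keeps the degree \<open>m - 1\<close> below the top;
      \<open>m = 0\<close> is degree -1.\<close>
    have "homology_zero K (link \<Delta> \<sigma>) (int m - 1)"
      using 0(3,4) by (intro link_homology_zero[OF True]) auto
    then obtain w :: "'v set \<Rightarrow> 'k" where
      "\<And>\<tau>. w \<tau> \<noteq> 0 \<Longrightarrow> \<tau> \<in> link \<Delta> \<sigma> \<and> face_dim \<tau> = int m - 1 + 1" "\<And>\<tau>. bd w \<tau> = z \<tau>"
      using homology_zero_bounds[of K "link \<Delta> \<sigma>" "int m - 1" z] 0(5,6) unfolding eq by blast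
    then show ?thesis using eq[of _ "Suc m"] by auto
  qed
next
  case (Suc n)
  obtain i where i: "i \<in> {1..d + 1}" "i \<notin> S" "i \<notin> \<rho> ` \<sigma>"
    using missing_color[OF Suc.prems(1,3)] .
  have fin: "finite S" using Suc.prems(1) finite_subset by blast
  have "\<exists>w. (\<forall>\<tau>. w \<tau> \<noteq> 0 \<longrightarrow> \<tau> \<in> colored_link \<sigma> (insert i S) (Suc m)) \<and> (\<forall>\<tau>. bd w \<tau> = z \<tau>)"
  proof (rule Suc.IH)
    show "\<tau> \<in> colored_link \<sigma> (insert i S) m" if "z \<tau> \<noteq> 0" for \<tau>
      using Suc.prems(5)[OF that] by (auto simp: colored_link_def)
  qed (use Suc.prems(1-4,6) i fin in auto)
  then obtain w :: "'v set \<Rightarrow> 'k" where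
    w: "\<And>\<tau>. w \<tau> \<noteq> 0 \<Longrightarrow> \<tau> \<in> colored_link \<sigma> (insert i S) (Suc m)" "\<And>\<tau>. bd w \<tau> = z \<tau>"
    by blast
  note del = color_deletion[OF i(2) w(1) Suc.prems(5) w(2)]
  have "\<exists>u. (\<forall>\<tau>. u \<tau> \<noteq> 0 \<longrightarrow> \<tau> \<in> colored_link (insert v \<sigma>) S (Suc m)) \<and>
      (\<forall>\<tau>. bd u \<tau> = residual v w \<tau>)" if v: "\<rho> v = i" for v
  proof (rule Suc.IH[OF Suc.prems(1) _ _ Suc.prems(4)])
    show "card S + card (insert v \<sigma>) + n = d + 1"
      using Suc.prems(3) v i(3) by (subst card_insert_disjoint) auto
  qed (use v i Suc.prems(2) del(1,2) in auto)
  then obtain u where u: "\<And>v \<tau>. \<rho> v = i \<Longrightarrow> u v \<tau> \<noteq> 0 \<Longrightarrow> \<tau> \<in> colored_link (insert v \<sigma>) S (Suc m)"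
    "\<And>v \<tau>. \<rho> v = i \<Longrightarrow> bd (u v) \<tau> = residual v w \<tau>"
    by metis
  \<comment> \<open>The fillings of the residuals replace the cones that were cut off together with
    the colour \<open>i\<close>.\<close>
  define y where "y \<tau> = (if \<rho> ` \<tau> \<subseteq> S then w \<tau> else 0) + (\<Sum>v | \<rho> v = i. u v \<tau>)" for \<tau>
  show ?case
  proof (intro exI conjI allI impI)
    show "bd y \<tau> = z \<tau>" for \<tau>
      unfolding y_def bd_add bd_sum using del(3)[of \<tau>] u(2) by simp
    fix \<tau> assume "y \<tau> \<noteq> 0"
    have "(\<rho> ` \<tau> \<subseteq> S \<and> w \<tau> \<noteq> 0) \<or> (\<exists>v. \<rho> v = i \<and> u v \<tau> \<noteq> 0)"
    proof (rule ccontr)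
      assume neg: "\<not> ?thesis"
      then have "(\<Sum>v | \<rho> v = i. u v \<tau>) = 0" by (intro sum.neutral) blast
      moreover have "(if \<rho> ` \<tau> \<subseteq> S then w \<tau> else 0) = 0" using neg by simp
      ultimately have "y \<tau> = 0" by (simp only: y_def add_0)
      then show False using \<open>y \<tau> \<noteq> 0\<close> by contradiction
    qed
    then show "\<tau> \<in> colored_link \<sigma> S (Suc m)"
    proof (elim disjE exE conjE)
      assume "\<rho> ` \<tau> \<subseteq> S" "w \<tau> \<noteq> 0"
      then show ?thesis using w(1)[of \<tau>] by (auto simp: colored_link_def)
    next
      fix v assume "\<rho> v = i" "u v \<tau> \<noteq> 0"
      then have "\<tau> \<in> colored_link (insert v \<sigma>) S (Suc m)" using u(1) by blast
      then show ?thesis using colored_link_mono[of v \<tau>] by (auto simp: colored_link_def)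
    qed
  qed
qed

end

section \<open>Signs of a bipartition\<close>

locale bipartitioned_sphere = balanced_homology_sphere K \<Delta> d \<rho>
  for K :: "'k::field itself" and \<Delta> :: "'v::{finite,linorder} set set" and d \<rho> +
  fixes B1 B2 :: "'v set set"
  assumes bipartition: "facet_ridge_bipartition \<Delta> B1 B2"
begin

definition facet_sign :: "'v set \<Rightarrow> 'k" where
  \<comment> \<open>The value 0 away from the facets lets sums run over all vertices outside a
    face.\<close>
  "facet_sign \<sigma> = (if \<sigma> \<in> B1 then 1 else if \<sigma> \<in> B2 then -1 else 0)"

lemma facet_sign_nonzero_iff: "facet_sign \<sigma> \<noteq> 0 \<longleftrightarrow> \<sigma> \<in> facets \<Delta>"
  using bipartition by (auto simp: facet_sign_def facet_ridge_bipartition_def)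

text \<open>A nonzero term makes \<tau> a ridge. Its two facets are adjacent, so they lie on
  opposite sides of the bipartition and their signs cancel.\<close>

lemma sum_facet_sign: "(\<Sum>v\<in>-\<tau>. facet_sign (insert v \<tau>)) = 0"
proof (cases "\<exists>v\<in>-\<tau>. facet_sign (insert v \<tau>) \<noteq> 0")
  case False
  then show ?thesis by (auto intro: sum.neutral)
next
  case True
  then obtain v where v: "v \<notin> \<tau>" "insert v \<tau> \<in> facets \<Delta>" by (auto simp: facet_sign_nonzero_iff)
  then have \<tau>: "\<tau> \<in> \<Delta>" "card \<tau> = d"
    using face_subset[of "insert v \<tau>" \<tau>] by (auto simp: facets_iff)
  obtain p q where pq: "p \<noteq> q" "{v\<in>-\<tau>. insert v \<tau> \<in> facets \<Delta>} = {p, q}"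
    using ridge_in_two_facets[OF \<tau>] .
  from pq(2) have p: "p \<notin> \<tau>" "insert p \<tau> \<in> facets \<Delta>" and q: "q \<notin> \<tau>" "insert q \<tau> \<in> facets \<Delta>"
    by auto
  have "insert p \<tau> \<inter> insert q \<tau> = \<tau>" using p q pq(1) by auto
  moreover have "insert p \<tau> \<noteq> insert q \<tau>" using p q pq(1) by auto
  ultimately have "facet_ridge_adj \<Delta> (insert p \<tau>) (insert q \<tau>)"
    using p q \<tau> by (simp add: facet_ridge_adj_def dim_eq face_dim_def)
  then have "facet_sign (insert p \<tau>) + facet_sign (insert q \<tau>) = 0"
    using bipartition p q by (auto simp: facet_ridge_bipartition_def facet_sign_def)
  moreover have "(\<Sum>v\<in>-\<tau>. facet_sign (insert v \<tau>)) = (\<Sum>v\<in>{p, q}. facet_sign (insert v \<tau>))"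
  proof (rule sum.mono_neutral_right)
    show "\<forall>v\<in>- \<tau> - {p, q}. facet_sign (insert v \<tau>) = 0"
      using pq(2) facet_sign_nonzero_iff by blast
  qed (use p q in auto)
  ultimately show ?thesis using pq(1) by simp
qed

text \<open>The coefficients of the dual form contracted by the monomial of \<sigma>, which is the
  dual form of the link of \<sigma>.\<close>

definition link_sign :: "'v set \<Rightarrow> 'v set \<Rightarrow> 'k" where
  "link_sign \<sigma> \<tau> = (if \<tau> \<inter> \<sigma> = {} then facet_sign (\<tau> \<union> \<sigma>) else 0)"

lemma sum_link_sign: "(\<Sum>v\<in>-\<tau>. link_sign \<sigma> (insert v \<tau>)) = 0"
proof (cases "\<tau> \<inter> \<sigma> = {}")
  case True
  have "(\<Sum>v\<in>-\<tau>. link_sign \<sigma> (insert v \<tau>)) = (\<Sum>v\<in>-(\<tau> \<union> \<sigma>). facet_sign (insert v (\<tau> \<union> \<sigma>)))"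
    using True by (intro sum.mono_neutral_cong_right) (auto simp: link_sign_def)
  then show ?thesis by (simp only: sum_facet_sign)
next
  case False
  then show ?thesis by (auto simp: link_sign_def intro!: sum.neutral)
qed

text \<open>The support consists of faces whose colours are exactly those missing from \<sigma>, so
  the unsigned cancellation at ridges becomes the cycle condition.\<close>

lemma bd_link_sign: "bd (\<lambda>\<tau>. inversion_sign \<rho> \<tau> * link_sign \<sigma> \<tau>) \<tau> = 0"
proof (rule bd_inversion_sign[where S = "{1..d + 1} - \<rho> ` \<sigma>"])
  show "(\<Sum>v\<in>-\<tau>. link_sign \<sigma> (insert v \<tau>)) = 0" for \<tau> by (rule sum_link_sign)
next
  fix \<tau> assume "link_sign \<sigma> \<tau> \<noteq> 0"
  then have disj: "\<tau> \<inter> \<sigma> = {}" and f: "\<tau> \<union> \<sigma> \<in> facets \<Delta>"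
    by (auto simp: link_sign_def facet_sign_nonzero_iff split: if_splits)
  have inj: "inj_on \<rho> (\<tau> \<union> \<sigma>)" using f rainbow by (simp add: facets_iff)
  then have "\<rho> ` (\<tau> \<union> \<sigma> - \<sigma>) = \<rho> ` (\<tau> \<union> \<sigma>) - \<rho> ` \<sigma>"
    by (intro inj_on_image_set_diff) auto
  moreover have "\<tau> \<union> \<sigma> - \<sigma> = \<tau>" using disj by auto
  ultimately show "inj_on \<rho> \<tau> \<and> \<rho> ` \<tau> = {1..d + 1} - \<rho> ` \<sigma>"
    using facet_colors[OF f] inj by (auto intro: inj_on_subset)
qed

text \<open>Induction on the number \<open>n\<close> of colours outside \<open>S\<close> and
  \<sigma>. For \<open>n = 0\<close> the cycles form a line containing the nonzero dual form of the
  link. Otherwise \<open>z\<close> bounds after admitting a new colour, and is a sum of cycles in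
  smaller links. Letting \<mu> range over all sets allows these combinations to be added
  coefficientwise.\<close>

lemma color_selected_cycles:
  fixes z :: "'v set \<Rightarrow> 'k"
  assumes "S \<subseteq> {1..d + 1}" "S \<inter> \<rho> ` \<sigma> = {}" "card S + card \<sigma> + n = d + 1"
    and "\<And>\<tau>. z \<tau> \<noteq> 0 \<Longrightarrow> \<tau> \<in> colored_link \<sigma> S (card S)" and "\<And>\<tau>. bd z \<tau> = 0"
  shows "\<exists>g. \<forall>\<tau>. z \<tau> = (\<Sum>\<mu>\<in>UNIV. g \<mu> * (inversion_sign \<rho> \<tau> * link_sign \<mu> \<tau>))"
  using assms
proof (induction n arbitrary: \<sigma> S z)
  case 0
  show ?case
  proof (cases "\<sigma> \<in> \<Delta>")
    case False
    then have "z \<tau> = 0" for \<tau>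
      using 0(4)[of \<tau>] face_subset[of "\<tau> \<union> \<sigma>" \<sigma>] by (auto simp: colored_link_def)
    then show ?thesis by (intro exI[of _ "\<lambda>_. 0"]) simp
  next
    case True
    obtain z\<^sub>0 :: "'v set \<Rightarrow> 'k" where
      gen: "\<And>z :: 'v set \<Rightarrow> 'k. (\<forall>\<tau>. z \<tau> \<noteq> 0 \<longrightarrow> \<tau> \<inter> \<sigma> = {} \<and> \<tau> \<union> \<sigma> \<in> facets \<Delta>)
         \<Longrightarrow> (\<forall>\<tau>. bd z \<tau> = 0) \<Longrightarrow> \<exists>a. \<forall>\<tau>. z \<tau> = a * z\<^sub>0 \<tau>"
      using link_top_cycles[OF True] by blast
    let ?F = "\<lambda>\<tau>. inversion_sign \<rho> \<tau> * link_sign \<sigma> \<tau>"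
    have "\<tau> \<inter> \<sigma> = {} \<and> \<tau> \<union> \<sigma> \<in> facets \<Delta>" if "?F \<tau> \<noteq> 0" for \<tau>
      using that by (auto simp: link_sign_def facet_sign_nonzero_iff split: if_splits)
    then obtain b where b: "\<And>\<tau>. ?F \<tau> = b * z\<^sub>0 \<tau>" using gen[of ?F] bd_link_sign by blast
    have "\<tau> \<inter> \<sigma> = {} \<and> \<tau> \<union> \<sigma> \<in> facets \<Delta>" if "z \<tau> \<noteq> 0" for \<tau>
      using 0(4)[OF that] 0(3) by (auto simp: colored_link_def facets_iff card_Un_disjoint)
    then obtain a where a: "\<And>\<tau>. z \<tau> = a * z\<^sub>0 \<tau>" using gen[of z] 0(5) by blast
    obtain G where G: "G \<in> facets \<Delta>" "\<sigma> \<subseteq> G" using facet_above True by blast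
    then have "(G - \<sigma>) \<union> \<sigma> \<in> facets \<Delta>" by (simp add: Un_absorb2)
    \<comment> \<open>A facet above \<sigma> shows that the dual form of the link is nonzero, so
      that it spans as well as \<open>z\<^sub>0\<close>.\<close>
    then have "?F (G - \<sigma>) \<noteq> 0" by (auto simp: link_sign_def facet_sign_nonzero_iff)
    then have "b \<noteq> 0" using b[of "G - \<sigma>"] by auto
    then have z: "z \<tau> = a / b * ?F \<tau>" for \<tau> using a b by simp
    have "z \<tau> = (\<Sum>\<mu>\<in>UNIV. (if \<mu> = \<sigma> then a / b else 0) * (inversion_sign \<rho> \<tau> * link_sign \<mu> \<tau>))" for \<tau>
      unfolding z by (subst sum.mono_neutral_right[of UNIV "{\<sigma>}"]) auto
    then show ?thesis by (intro exI allI)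
  qed
next
  case (Suc n)
  obtain i where i: "i \<in> {1..d + 1}" "i \<notin> S" "i \<notin> \<rho> ` \<sigma>"
    using missing_color[OF Suc.prems(1,3)] .
  have fin: "finite S" using Suc.prems(1) finite_subset by blast
  have "\<exists>w. (\<forall>\<tau>. w \<tau> \<noteq> 0 \<longrightarrow> \<tau> \<in> colored_link \<sigma> (insert i S) (Suc (card S))) \<and> (\<forall>\<tau>. bd w \<tau> = z \<tau>)"
  proof (rule color_selected_acyclic)
    show "card (insert i S) + card \<sigma> + n = d + 1" using Suc.prems(3) i fin by simp
    show "\<tau> \<in> colored_link \<sigma> (insert i S) (card S)" if "z \<tau> \<noteq> 0" for \<tau>
      using Suc.prems(4)[OF that] by (auto simp: colored_link_def)
  qed (use Suc.prems(1,2,5) i fin in auto)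
  then obtain w :: "'v set \<Rightarrow> 'k" where
    w: "\<And>\<tau>. w \<tau> \<noteq> 0 \<Longrightarrow> \<tau> \<in> colored_link \<sigma> (insert i S) (Suc (card S))" "\<And>\<tau>. bd w \<tau> = z \<tau>"
    by blast
  note del = color_deletion[OF i(2) w(1) Suc.prems(4) w(2)]
  have "\<exists>g. \<forall>\<tau>. residual v w \<tau> = (\<Sum>\<mu>\<in>UNIV. g \<mu> * (inversion_sign \<rho> \<tau> * link_sign \<mu> \<tau>))"
    if v: "\<rho> v = i" for v
  proof (rule Suc.IH[OF Suc.prems(1)])
    show "card S + card (insert v \<sigma>) + n = d + 1"
      using Suc.prems(3) v i(3) by (subst card_insert_disjoint) auto
  qed (use v i Suc.prems(2) del(1,2) in auto)
  then obtain g where g: "\<And>v \<tau>. \<rho> v = i \<Longrightarrow>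
      residual v w \<tau> = (\<Sum>\<mu>\<in>UNIV. g v \<mu> * (inversion_sign \<rho> \<tau> * link_sign \<mu> \<tau>))"
    by metis
  \<comment> \<open>A face with \<open>card S + 1\<close> vertices has as many colours, so nothing
    of \<open>w\<close> survives the truncation to \<open>S\<close>.\<close>
  have w0: "(if \<rho> ` \<tau> \<subseteq> S then w \<tau> else 0) = 0" for \<tau>
  proof (rule ccontr)
    assume "\<not> ?thesis"
    then have *: "\<rho> ` \<tau> \<subseteq> S" "w \<tau> \<noteq> 0" by (auto split: if_splits)
    then have "\<tau> \<union> \<sigma> \<in> \<Delta>" "card \<tau> = Suc (card S)" using w(1) by (auto simp: colored_link_def)
    moreover have "\<tau> \<in> \<Delta>" using face_subset[OF \<open>\<tau> \<union> \<sigma> \<in> \<Delta>\<close>] by auto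
    ultimately show False using card_mono[OF fin *(1)] face_card_colors by simp
  qed
  have "z \<tau> = (\<Sum>\<mu>\<in>UNIV. (\<Sum>v | \<rho> v = i. g v \<mu>) * (inversion_sign \<rho> \<tau> * link_sign \<mu> \<tau>))" for \<tau>
  proof -
    have "z \<tau> = (\<Sum>v | \<rho> v = i. residual v w \<tau>)"
      using del(3)[of \<tau>] unfolding w0 by (simp add: bd_def)
    also have "\<dots> = (\<Sum>v | \<rho> v = i. \<Sum>\<mu>\<in>UNIV. g v \<mu> * (inversion_sign \<rho> \<tau> * link_sign \<mu> \<tau>))"
      using g by (intro sum.cong) auto
    also have "\<dots> = (\<Sum>\<mu>\<in>UNIV. \<Sum>v | \<rho> v = i. g v \<mu> * (inversion_sign \<rho> \<tau> * link_sign \<mu> \<tau>))"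
      by (rule sum.swap)
    finally show ?thesis by (simp only: sum_distrib_right)
  qed
  then show ?case by (intro exI allI)
qed

text \<open>The function splits by the colour set of its faces; each piece, weighted by inversion
  signs, is a cycle to which the description of colour-selected cycles applies with \<sigma>
  empty.\<close>

lemma balanced_functions:
  fixes c :: "'v set \<Rightarrow> 'k"
  assumes supp: "\<And>\<tau>. c \<tau> \<noteq> 0 \<Longrightarrow> \<tau> \<in> \<Delta>"
    and balance: "\<And>\<tau> i. i \<notin> \<rho> ` \<tau> \<Longrightarrow> (\<Sum>v | \<rho> v = i. c (insert v \<tau>)) = 0"
  obtains g where "\<And>\<tau>. c \<tau> = (\<Sum>\<mu>\<in>UNIV. g \<mu> * link_sign \<mu> \<tau>)"
proof -
  define cS where "cS S \<tau> = (if \<rho> ` \<tau> = S then c \<tau> else 0)" for S \<tau>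
  have "\<exists>g. \<forall>\<tau>. inversion_sign \<rho> \<tau> * cS S \<tau>
      = (\<Sum>\<mu>\<in>UNIV. g \<mu> * (inversion_sign \<rho> \<tau> * link_sign \<mu> \<tau>))" if S: "S \<subseteq> {1..d + 1}" for S
  proof (rule color_selected_cycles[OF S, where \<sigma> = "{}" and n = "d + 1 - card S"])
    show "card S + card {} + (d + 1 - card S) = d + 1"
      using card_mono[OF _ S] by simp
    show "\<tau> \<in> colored_link {} S (card S)" if "inversion_sign \<rho> \<tau> * cS S \<tau> \<noteq> 0" for \<tau>
      using that supp[of \<tau>] face_card_colors[of \<tau>]
      by (auto simp: cS_def colored_link_def split: if_splits)
    show "bd (\<lambda>\<tau>. inversion_sign \<rho> \<tau> * cS S \<tau>) \<tau> = 0" for \<tau>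
    proof (rule bd_inversion_sign[where S = S])
      show "inj_on \<rho> \<tau> \<and> \<rho> ` \<tau> = S" if "cS S \<tau> \<noteq> 0" for \<tau>
        using that supp rainbow by (auto simp: cS_def split: if_splits)
    next
      fix \<tau>
      show "(\<Sum>v\<in>-\<tau>. cS S (insert v \<tau>)) = 0"
      proof (cases "\<exists>v\<in>-\<tau>. cS S (insert v \<tau>) \<noteq> 0")
        case False
        then show ?thesis by (auto intro: sum.neutral)
      next
        case True
        then obtain w where w: "w \<notin> \<tau>" "cS S (insert w \<tau>) \<noteq> 0" by auto
        have new: "\<rho> v \<notin> \<rho> ` \<tau>" if "v \<notin> \<tau>" "c (insert v \<tau>) \<noteq> 0" for v
          using rainbow[OF supp[OF that(2)]] that(1) by (auto simp: inj_on_def)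
        have cw: "c (insert w \<tau>) \<noteq> 0" "S = insert (\<rho> w) (\<rho> ` \<tau>)"
          using w(2) by (auto simp: cS_def split: if_splits)
        have wn: "\<rho> w \<notin> \<rho> ` \<tau>" using new[OF w(1) cw(1)] .
        then have wn': "\<rho> v \<noteq> \<rho> w" if "v \<in> \<tau>" for v using that by (metis imageI)
        \<comment> \<open>Only the colour of \<open>w\<close> completes the colours of \<tau> to
          \<open>S\<close>, so the sum over all added vertices reduces to a balance condition for
          one colour.\<close>
        have "(\<Sum>v\<in>-\<tau>. cS S (insert v \<tau>)) = (\<Sum>v | \<rho> v = \<rho> w. c (insert v \<tau>))"
        proof (rule sum.mono_neutral_cong)
          fix v assume v: "v \<in> - \<tau> - {v. \<rho> v = \<rho> w}"
          show "cS S (insert v \<tau>) = 0"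
          proof (rule ccontr)
            assume "\<not> ?thesis"
            then have "c (insert v \<tau>) \<noteq> 0" "insert (\<rho> v) (\<rho> ` \<tau>) = S"
              by (auto simp: cS_def split: if_splits)
            then show False using new[of v] v cw(2) by auto
          qed
        qed (use wn' cw(2) in \<open>auto simp: cS_def\<close>)
        also have "\<dots> = 0" by (rule balance[OF wn])
        finally show ?thesis .
      qed
    qed
  qed simp
  then have "\<exists>g. \<forall>\<tau>. cS S \<tau> = (\<Sum>\<mu>\<in>UNIV. g \<mu> * link_sign \<mu> \<tau>)" if S: "S \<subseteq> {1..d + 1}" for S
  proof -
    from \<open>\<And>S. S \<subseteq> {1..d + 1} \<Longrightarrow> _\<close>[OF S] obtain g where
      g: "\<And>\<tau>. inversion_sign \<rho> \<tau> * cS S \<tau> = (\<Sum>\<mu>\<in>UNIV. g \<mu> * (inversion_sign \<rho> \<tau> * link_sign \<mu> \<tau>))"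
      by blast
    have "inversion_sign \<rho> \<tau> * cS S \<tau> = inversion_sign \<rho> \<tau> * (\<Sum>\<mu>\<in>UNIV. g \<mu> * link_sign \<mu> \<tau>)" for \<tau>
      unfolding g sum_distrib_left by (intro sum.cong) (auto simp: algebra_simps)
    then show ?thesis by auto
  qed
  then obtain g where g: "\<And>S \<tau>. S \<subseteq> {1..d + 1} \<Longrightarrow> cS S \<tau> = (\<Sum>\<mu>\<in>UNIV. g S \<mu> * link_sign \<mu> \<tau>)"
    by metis
  have "c \<tau> = (\<Sum>\<mu>\<in>UNIV. (\<Sum>S\<in>Pow {1..d + 1}. g S \<mu>) * link_sign \<mu> \<tau>)" for \<tau>
  proof -
    have "\<rho> ` \<tau> \<subseteq> {1..d + 1}" using color_range by auto
    then have "c \<tau> = (\<Sum>S\<in>Pow {1..d + 1}. cS S \<tau>)"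
      by (simp add: cS_def sum.delta)
    also have "\<dots> = (\<Sum>S\<in>Pow {1..d + 1}. \<Sum>\<mu>\<in>UNIV. g S \<mu> * link_sign \<mu> \<tau>)"
      using g by (intro sum.cong) auto
    also have "\<dots> = (\<Sum>\<mu>\<in>UNIV. \<Sum>S\<in>Pow {1..d + 1}. g S \<mu> * link_sign \<mu> \<tau>)"
      by (rule sum.swap)
    finally show ?thesis by (simp only: sum_distrib_right)
  qed
  then show thesis by (rule that)
qed

end

section \<open>Contraction\<close>

text \<open>Subtraction of exponents is truncated; together with divisibility it becomes an
  addition, which is what coefficient computations use.\<close>

lemma le_diff_iff_eq_add:
  fixes a b c :: "'v \<Rightarrow>\<^sub>0 nat"
  shows "(\<forall>v. lookup a v \<le> lookup c v) \<and> c - a = b \<longleftrightarrow> c = a + b"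
  by (auto intro!: poly_mapping_eqI simp: lookup_minus lookup_add)

text \<open>The index set may exceed the support of \<open>g\<close>, so that several polynomials
  can be summed over a common set.\<close>

lemma lookup_contract_superset:
  assumes "finite A" "keys g \<subseteq> A"
  shows "lookup (contract g F) b = (\<Sum>a\<in>A. lookup g a * lookup F (a + b))"
proof -
  have "lookup (contract g F) b = (\<Sum>a\<in>keys g. \<Sum>c\<in>keys F.
      if c = a + b then lookup g a * lookup F c else 0)"
    unfolding contract_def lookup_sum
    using le_diff_iff_eq_add by (intro sum.cong) (auto simp: lookup_single when_def)
  also have "\<dots> = (\<Sum>a\<in>keys g. lookup g a * lookup F (a + b))"
    by (intro sum.cong) (auto simp: in_keys_iff)
  also have "\<dots> = (\<Sum>a\<in>A. lookup g a * lookup F (a + b))"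
    using assms by (intro sum.mono_neutral_left) (auto simp: in_keys_iff)
  finally show ?thesis .
qed

lemmas lookup_contract = lookup_contract_superset[OF finite_keys subset_refl]

lemma contract_add: "contract (g + h) F = contract g F + contract h F"
proof (rule poly_mapping_eqI)
  fix b
  have A: "finite (keys g \<union> keys h)" by simp
  show "lookup (contract (g + h) F) b = lookup (contract g F + contract h F) b"
    using lookup_contract_superset[OF A, of g] lookup_contract_superset[OF A, of h]
      lookup_contract_superset[OF A, of "g + h"] Poly_Mapping.keys_add[of g h]
    by (simp add: lookup_add sum.distrib distrib_right)
qed

lemma contract_0_left [simp]: "contract 0 F = 0"
  by (simp add: contract_def)

lemma contract_0_right [simp]: "contract g 0 = 0"
  by (simp add: contract_def)

lemma contract_sum: "contract (\<Sum>i\<in>A. g i) F = (\<Sum>i\<in>A. contract (g i) F)"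
  by (induction A rule: infinite_finite_induct) (auto simp: contract_add)

lemma lookup_contract_single:
  "lookup (contract (Poly_Mapping.single m c) F) b = c * lookup F (m + b)"
  by (subst lookup_contract_superset[of "{m}"]) auto

lemma sum_single_keys: "p = (\<Sum>a\<in>keys p. Poly_Mapping.single a (lookup p a))"
  by (rule poly_mapping_eqI) (auto simp: lookup_sum lookup_single when_def in_keys_iff)

text \<open>Both sides expand over pairs of monomials with the same coefficient of \<open>F\<close>.
  Contraction is thus a module action.\<close>

lemma contract_mult: "contract (g * h) F = contract g (contract h F)"
proof (rule poly_mapping_eqI)
  fix b
  have "g * h = (\<Sum>a\<in>keys g. Poly_Mapping.single a (lookup g a)) * (\<Sum>c\<in>keys h. Poly_Mapping.single c (lookup h c))"
    by (simp only: sum_single_keys[symmetric])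
  also have "\<dots> = (\<Sum>a\<in>keys g. \<Sum>c\<in>keys h. Poly_Mapping.single (a + c) (lookup g a * lookup h c))"
    by (simp add: sum_product mult_single)
  finally have "lookup (contract (g * h) F) b
      = (\<Sum>a\<in>keys g. \<Sum>c\<in>keys h. lookup g a * lookup h c * lookup F (a + c + b))"
    by (simp only: contract_sum lookup_sum lookup_contract_single)
  also have "\<dots> = lookup (contract g (contract h F)) b"
    unfolding lookup_contract sum_distrib_left by (intro sum.cong) (auto simp: ac_simps)
  finally show "lookup (contract (g * h) F) b = lookup (contract g (contract h F)) b" .
qed

section \<open>Annihilators and inverse systems of generated ideals\<close>

lemma module_times: "module ((*) :: 'a::comm_ring_1 \<Rightarrow> 'a \<Rightarrow> 'a)"
  by unfold_locales (auto simp: algebra_simps)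

text \<open>The polynomials annihilating \<open>F\<close> form an ideal, so it contains the ideal
  generated by any of its subsets.\<close>

lemma contract_ideal_generated:
  assumes "\<And>g. g \<in> G \<Longrightarrow> contract g F = 0" "h \<in> ideal_generated G"
  shows "contract h F = 0"
proof -
  have "module.subspace (*) {h. contract h F = 0}"
    by (simp add: module.subspace_def[OF module_times] contract_add contract_mult)
  then have "ideal_generated G \<subseteq> {h. contract h F = 0}"
    unfolding ideal_generated_def using assms(1) by (intro module.span_minimal[OF module_times]) auto
  then show ?thesis using assms(2) by auto
qed

lemma ideal_generated_base: "g \<in> G \<Longrightarrow> g \<in> ideal_generated G"
  unfolding ideal_generated_def by (rule module.span_base[OF module_times])

lemma ideal_generated_zero: "0 \<in> ideal_generated G"
  unfolding ideal_generated_def by (rule module.span_zero[OF module_times])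

lemma inverse_system_generated:
  "F \<in> inverse_system (ideal_plus (ideal_generated A) (ideal_generated B))
    \<longleftrightarrow> (\<forall>g\<in>A \<union> B. contract g F = 0)"
proof
  assume F: "F \<in> inverse_system (ideal_plus (ideal_generated A) (ideal_generated B))"
  show "\<forall>g\<in>A \<union> B. contract g F = 0"
  proof
    fix g assume "g \<in> A \<union> B"
    then obtain a b where "g = a + b" "a \<in> ideal_generated A" "b \<in> ideal_generated B"
    proof
      assume "g \<in> A"
      then show thesis by (intro that[of g 0]) (simp_all add: ideal_generated_base ideal_generated_zero)
    next
      assume "g \<in> B"
      then show thesis by (intro that[of 0 g]) (simp_all add: ideal_generated_base ideal_generated_zero)
    qed
    then show "contract g F = 0"
      using F unfolding inverse_system_def ideal_plus_def by blast
  qed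
next
  assume gens: "\<forall>g\<in>A \<union> B. contract g F = 0"
  have "contract a F = 0" if "a \<in> ideal_generated A" for a
    using gens by (intro contract_ideal_generated[OF _ that]) simp
  moreover have "contract b F = 0" if "b \<in> ideal_generated B" for b
    using gens by (intro contract_ideal_generated[OF _ that]) simp
  ultimately show "F \<in> inverse_system (ideal_plus (ideal_generated A) (ideal_generated B))"
    by (auto simp: inverse_system_def ideal_plus_def contract_add)
qed

section \<open>Squarefree monomials\<close>

definition face_exponent :: "'v::finite set \<Rightarrow> 'v \<Rightarrow>\<^sub>0 nat" where
  "face_exponent \<sigma> = (\<Sum>v\<in>\<sigma>. Poly_Mapping.single v 1)"

lemma lookup_face_exponent: "lookup (face_exponent \<sigma>) v = (if v \<in> \<sigma> then 1 else 0)"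
  by (simp add: face_exponent_def lookup_sum lookup_single when_def)

lemma face_exponent_inj [simp]: "face_exponent \<sigma> = face_exponent \<tau> \<longleftrightarrow> \<sigma> = \<tau>"
proof
  assume "face_exponent \<sigma> = face_exponent \<tau>"
  then have "lookup (face_exponent \<sigma>) v = lookup (face_exponent \<tau>) v" for v by simp
  then have "v \<in> \<sigma> \<longleftrightarrow> v \<in> \<tau>" for v
    unfolding lookup_face_exponent by (metis zero_neq_one)
  then show "\<sigma> = \<tau>" by blast
qed simp

lemma face_monomial_eq_single: "face_monomial \<sigma> = Poly_Mapping.single (face_exponent \<sigma>) 1"
proof -
  have "finite \<sigma>" by simp
  then show ?thesis unfolding face_monomial_def face_exponent_def
    by induction (auto simp: var_def mult_single)
qed

lemma face_exponent_union:
  "\<sigma> \<inter> \<tau> = {} \<Longrightarrow> face_exponent \<sigma> + face_exponent \<tau> = face_exponent (\<sigma> \<union> \<tau>)"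
  by (simp add: face_exponent_def sum.union_disjoint)

lemma face_exponent_insert:
  "v \<notin> \<tau> \<Longrightarrow> Poly_Mapping.single v 1 + face_exponent \<tau> = face_exponent (insert v \<tau>)"
  by (simp add: face_exponent_def)

text \<open>Where two natural numbers add up to at most 1, at most one of them is 1: factors of a
  squarefree monomial are squarefree with disjoint supports.\<close>

lemma face_exponent_summands:
  assumes "a + b = face_exponent \<sigma>"
  obtains \<alpha> \<beta> where "a = face_exponent \<alpha>" "b = face_exponent \<beta>" "\<alpha> \<inter> \<beta> = {}" "\<alpha> \<union> \<beta> = \<sigma>"
proof -
  have eq: "lookup a v + lookup b v = (if v \<in> \<sigma> then 1 else 0)" for v
    using assms by (metis lookup_add lookup_face_exponent)
  let ?\<alpha> = "{v. lookup a v = 1}" and ?\<beta> = "{v. lookup b v = 1}"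
  have 01: "(lookup a v = 0 \<or> lookup a v = 1) \<and> (lookup b v = 0 \<or> lookup b v = 1)" for v
    using eq[of v] by (auto split: if_splits)
  show thesis
  proof
    show a: "a = face_exponent ?\<alpha>" and b: "b = face_exponent ?\<beta>"
      by (rule poly_mapping_eqI, use 01 in \<open>force simp: lookup_face_exponent\<close>)+
    show disj: "?\<alpha> \<inter> ?\<beta> = {}"
    proof (rule equals0I)
      fix v assume "v \<in> ?\<alpha> \<inter> ?\<beta>"
      then show False using eq[of v] by (auto split: if_splits)
    qed
    show "?\<alpha> \<union> ?\<beta> = \<sigma>"
      using face_exponent_union[OF disj] a b assms by simp
  qed
qed

lemma lookup_contract_face_monomial:
  "lookup (contract (face_monomial \<sigma>) F) b = lookup F (face_exponent \<sigma> + b)"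
  by (simp add: face_monomial_eq_single lookup_contract_single)

lemma lookup_contract_colored_sop:
  "lookup (contract (colored_sop \<rho> i) F) b = (\<Sum>v | \<rho> v = i. lookup F (Poly_Mapping.single v 1 + b))"
  by (simp add: colored_sop_def contract_sum lookup_sum var_def lookup_contract_single)

section \<open>The dual generator\<close>

context bipartitioned_sphere
begin

definition dual_form :: "('v, 'k) mpoly" where
  "dual_form = (\<Sum>\<sigma>\<in>B1. face_monomial \<sigma>) - (\<Sum>\<sigma>\<in>B2. face_monomial \<sigma>)"

abbreviation colored_ideal :: "('v, 'k) mpoly set" where
  "colored_ideal \<equiv> ideal_plus (stanley_reisner_ideal \<Delta>)
     (ideal_generated {colored_sop \<rho> i |i. i \<in> {1..d + 1}})"

section \<open>Coefficients of the dual form\<close>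

lemma lookup_dual_form_face: "lookup dual_form (face_exponent \<sigma>) = facet_sign \<sigma>"
proof -
  have "lookup dual_form (face_exponent \<sigma>) = (if \<sigma> \<in> B1 then 1 else 0) - (if \<sigma> \<in> B2 then 1 else 0)"
    by (simp add: dual_form_def face_monomial_eq_single lookup_minus lookup_sum lookup_single when_def)
  moreover have "B1 \<inter> B2 = {}" using bipartition by (simp add: facet_ridge_bipartition_def)
  ultimately show ?thesis by (auto simp: facet_sign_def)
qed

lemma lookup_dual_form_nonzero:
  assumes "lookup dual_form b \<noteq> 0"
  obtains \<sigma> where "\<sigma> \<in> facets \<Delta>" "b = face_exponent \<sigma>"
proof -
  have "\<exists>\<sigma>. b = face_exponent \<sigma>"
  proof (rule ccontr)
    assume "\<nexists>\<sigma>. b = face_exponent \<sigma>"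
    then have "face_exponent \<sigma> \<noteq> b" for \<sigma> by metis
    then have "lookup dual_form b = 0"
      by (simp add: dual_form_def face_monomial_eq_single lookup_minus lookup_sum lookup_single)
    then show False using assms by simp
  qed
  then obtain \<sigma> where "b = face_exponent \<sigma>" by blast
  then show thesis
    using that[of \<sigma>] assms by (simp add: lookup_dual_form_face facet_sign_nonzero_iff)
qed

text \<open>If \<mu> and \<tau> meet, the product monomial contains a square and does not occur in
  the dual form.\<close>

lemma lookup_dual_form_sum:
  "lookup dual_form (face_exponent \<mu> + face_exponent \<tau>) = link_sign \<mu> \<tau>"
proof (cases "\<mu> \<inter> \<tau> = {}")
  case True
  then show ?thesis
    by (simp add: face_exponent_union lookup_dual_form_face link_sign_def Un_commute Int_commute)
next
  case False
  then have "face_exponent \<mu> + face_exponent \<tau> \<noteq> face_exponent \<sigma>" for \<sigma>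
    by (metis face_exponent_inj face_exponent_summands)
  then have "lookup dual_form (face_exponent \<mu> + face_exponent \<tau>) = 0"
    using lookup_dual_form_nonzero by metis
  then show ?thesis using False by (auto simp: link_sign_def)
qed

text \<open>It suffices to test generators, and each test is read off coefficientwise. This gives
  the linear conditions to which \<open>balanced_functions\<close> applies.\<close>

lemma mem_inverse_system:
  "G \<in> inverse_system colored_ideal \<longleftrightarrow>
    (\<forall>\<sigma> b. \<sigma> \<notin> \<Delta> \<longrightarrow> lookup G (face_exponent \<sigma> + b) = 0) \<and>
    (\<forall>i b. i \<in> {1..d + 1} \<longrightarrow> (\<Sum>v | \<rho> v = i. lookup G (Poly_Mapping.single v 1 + b)) = 0)"
proof -
  have "G \<in> inverse_system colored_ideal \<longleftrightarrow>
      (\<forall>\<sigma>. \<sigma> \<notin> \<Delta> \<longrightarrow> contract (face_monomial \<sigma>) G = 0) \<and>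
      (\<forall>i. i \<in> {1..d + 1} \<longrightarrow> contract (colored_sop \<rho> i) G = 0)"
    unfolding stanley_reisner_ideal_def inverse_system_generated by blast
  then show ?thesis
    unfolding poly_mapping_eq_iff fun_eq_iff lookup_contract_face_monomial
      lookup_contract_colored_sop lookup_zero by blast
qed

text \<open>Every monomial of the dual form comes from a facet, hence from no multiple of a nonface.
  A nonzero term of a colour sum makes \<open>b\<close> the exponent of a ridge, where the facet
  signs cancel.\<close>

lemma dual_form_in_inverse_system: "dual_form \<in> inverse_system colored_ideal"
  unfolding mem_inverse_system
proof (intro conjI allI impI)
  fix \<sigma> b assume "\<sigma> \<notin> \<Delta>"
  show "lookup dual_form (face_exponent \<sigma> + b) = 0"
  proof (rule ccontr)
    assume "\<not> ?thesis"
    then obtain G where "G \<in> facets \<Delta>" "face_exponent \<sigma> + b = face_exponent G"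
      using lookup_dual_form_nonzero by blast
    then show False
      using face_exponent_summands[of "face_exponent \<sigma>" b G] face_subset[of G \<sigma>] \<open>\<sigma> \<notin> \<Delta>\<close>
      by (metis Un_upper1 face_exponent_inj facets_iff)
  qed
next
  fix i b assume i: "i \<in> {1..d + 1}"
  show "(\<Sum>v | \<rho> v = i. lookup dual_form (Poly_Mapping.single v 1 + b)) = 0"
  proof (cases "\<exists>v. \<rho> v = i \<and> lookup dual_form (Poly_Mapping.single v 1 + b) \<noteq> 0")
    case False
    then show ?thesis by (auto intro: sum.neutral)
  next
    case True
    then obtain w G where w: "\<rho> w = i" "G \<in> facets \<Delta>" "Poly_Mapping.single w 1 + b = face_exponent G"
      using lookup_dual_form_nonzero by metis
    have single: "Poly_Mapping.single v 1 = face_exponent {v}" for v by (simp add: face_exponent_def)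
    obtain \<tau> where \<tau>: "b = face_exponent \<tau>" "w \<notin> \<tau>" "insert w \<tau> = G"
      using face_exponent_summands[OF w(3)] single
      by (metis Un_insert_left Un_empty_left disjoint_insert(1) face_exponent_inj insert_disjoint(1))
    have "inj_on \<rho> (insert w \<tau>)" using w(2) \<tau>(3) rainbow by (simp add: facets_iff)
    then have "i \<notin> \<rho> ` \<tau>" using w(1) \<tau>(2) by (auto simp: inj_on_def)
    \<comment> \<open>Every facet contains the colour \<open>i\<close> and \<tau> does not, so only
      vertices of colour \<open>i\<close> complete \<tau> to a facet.\<close>
    have "(\<Sum>v | \<rho> v = i. lookup dual_form (Poly_Mapping.single v 1 + b))
        = (\<Sum>v\<in>-\<tau>. facet_sign (insert v \<tau>))"
    proof (rule sum.mono_neutral_cong_left)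
      show "{v. \<rho> v = i} \<subseteq> - \<tau>" using \<open>i \<notin> \<rho> ` \<tau>\<close> by auto
      show "\<forall>v\<in>- \<tau> - {v. \<rho> v = i}. facet_sign (insert v \<tau>) = 0"
      proof (intro ballI, rule ccontr)
        fix v assume v: "v \<in> - \<tau> - {v. \<rho> v = i}" "facet_sign (insert v \<tau>) \<noteq> 0"
        then have "i \<in> \<rho> ` insert v \<tau>" using facet_colors i facet_sign_nonzero_iff by metis
        then show False using v(1) \<open>i \<notin> \<rho> ` \<tau>\<close> by auto
      qed
      show "lookup dual_form (Poly_Mapping.single v 1 + b) = facet_sign (insert v \<tau>)"
        if "v \<in> {v. \<rho> v = i}" for v
      proof -
        have "v \<notin> \<tau>" using that \<open>i \<notin> \<rho> ` \<tau>\<close> by auto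
        then show ?thesis by (simp only: \<tau>(1) face_exponent_insert[OF \<open>v \<notin> \<tau>\<close>] lookup_dual_form_face)
      qed
    qed simp
    then show ?thesis by (simp add: sum_facet_sign)
  qed
qed

text \<open>If the square of \<open>v\<close> divides the monomial, remove one \<open>v\<close> and
  take the sum for its colour: each other vertex of that colour forms a nonface with the remaining
  \<open>v\<close>, so the coefficient itself is 0.\<close>

lemma inverse_system_squarefree:
  assumes "G \<in> inverse_system colored_ideal" and "lookup G b \<noteq> 0"
  obtains \<tau> where "b = face_exponent \<tau>"
proof -
  have "lookup b v \<le> 1" for v
  proof (rule ccontr)
    assume "\<not> ?thesis"
    then have b: "b = Poly_Mapping.single v 1 + (Poly_Mapping.single v 1 + (b - Poly_Mapping.single v 2))"
      (is "b = _ + ?b")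
      by (intro poly_mapping_eqI) (auto simp: lookup_add lookup_minus lookup_single when_def)
    have "lookup G (Poly_Mapping.single u 1 + ?b) = 0" if "\<rho> u = \<rho> v" "u \<noteq> v" for u
    proof -
      have "{u, v} \<notin> \<Delta>" using rainbow[of "{u, v}"] that by auto
      moreover have "Poly_Mapping.single u 1 + ?b = face_exponent {u, v} + (b - Poly_Mapping.single v 2)"
        using that by (simp add: face_exponent_def add.assoc)
      ultimately show ?thesis using assms(1) unfolding mem_inverse_system by metis
    qed
    then have "(\<Sum>u | \<rho> u = \<rho> v. lookup G (Poly_Mapping.single u 1 + ?b))
        = (\<Sum>u\<in>{v}. lookup G (Poly_Mapping.single u 1 + ?b))"
      by (intro sum.mono_neutral_right) auto
    moreover have "(\<Sum>u | \<rho> u = \<rho> v. lookup G (Poly_Mapping.single u 1 + ?b)) = 0"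
      using assms(1) color_range unfolding mem_inverse_system by blast
    ultimately show False using assms(2) b by simp
  qed
  then have "b = face_exponent {v. lookup b v = 1}"
    by (intro poly_mapping_eqI) (auto simp: lookup_face_exponent le_Suc_eq)
  then show thesis by (rule that)
qed

text \<open>The squarefree coefficients satisfy the balance conditions and are combinations of link
  signs, that is, of contractions of the dual form. All other coefficients vanish on both
  sides.\<close>

lemma inverse_system_contraction:
  assumes G: "G \<in> inverse_system colored_ideal"
  shows "\<exists>h. G = contract h dual_form"
proof -
  have faces: "lookup G (face_exponent \<sigma> + b) = 0" if "\<sigma> \<notin> \<Delta>" for \<sigma> b
    using G that unfolding mem_inverse_system by blast
  have colors: "(\<Sum>v | \<rho> v = i. lookup G (Poly_Mapping.single v 1 + b)) = 0" if "i \<in> {1..d + 1}" for i b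
    using G that unfolding mem_inverse_system by blast
  obtain g where g: "\<And>\<tau>. lookup G (face_exponent \<tau>) = (\<Sum>\<mu>\<in>UNIV. g \<mu> * link_sign \<mu> \<tau>)"
  proof (rule balanced_functions)
    show "\<tau> \<in> \<Delta>" if "lookup G (face_exponent \<tau>) \<noteq> 0" for \<tau>
      using faces[of \<tau> 0] that by (cases "\<tau> \<in> \<Delta>") simp_all
    show "(\<Sum>v | \<rho> v = i. lookup G (face_exponent (insert v \<tau>))) = 0" if "i \<notin> \<rho> ` \<tau>" for \<tau> i
    proof (cases "i \<in> {1..d + 1}")
      case True
      have "(\<Sum>v | \<rho> v = i. lookup G (face_exponent (insert v \<tau>)))
          = (\<Sum>v | \<rho> v = i. lookup G (Poly_Mapping.single v 1 + face_exponent \<tau>))"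
      proof (rule sum.cong[OF refl])
        fix v assume "v \<in> {v. \<rho> v = i}"
        then have "v \<notin> \<tau>" using that by auto
        then show "lookup G (face_exponent (insert v \<tau>))
            = lookup G (Poly_Mapping.single v 1 + face_exponent \<tau>)"
          by (simp only: face_exponent_insert[OF \<open>v \<notin> \<tau>\<close>])
      qed
      also have "\<dots> = 0" by (rule colors[OF True])
      finally show ?thesis .
    next
      case False
      then have "{v. \<rho> v = i} = {}" using color_range by blast
      then show ?thesis by simp
    qed
  qed blast
  \<comment> \<open>The coefficient of each link sign becomes the coefficient of the squarefree
    monomial by which the dual form is contracted.\<close>
  define h where "h = (\<Sum>\<mu>\<in>UNIV. Poly_Mapping.single (face_exponent \<mu>) (g \<mu>))"
  have h: "lookup (contract h dual_form) b = (\<Sum>\<mu>\<in>UNIV. g \<mu> * lookup dual_form (face_exponent \<mu> + b))" for b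
    by (simp add: h_def contract_sum lookup_sum lookup_contract_single)
  have "G = contract h dual_form"
  proof (rule poly_mapping_eqI)
    fix b
    show "lookup G b = lookup (contract h dual_form) b"
    proof (cases "\<exists>\<tau>. b = face_exponent \<tau>")
      case True
      then obtain \<tau> where "b = face_exponent \<tau>" by blast
      then show ?thesis by (simp only: h g lookup_dual_form_sum)
    next
      case False
      have "lookup dual_form (face_exponent \<mu> + b) = 0" for \<mu>
      proof (rule ccontr)
        assume "\<not> ?thesis"
        then obtain \<sigma> where "face_exponent \<mu> + b = face_exponent \<sigma>"
          by (rule lookup_dual_form_nonzero)
        then show False by (rule face_exponent_summands) (use False in blast)
      qed
      moreover have "lookup G b = 0" using inverse_system_squarefree[OF G] False by blast
      ultimately show ?thesis unfolding h by simp
    qed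
  qed
  then show ?thesis ..
qed

lemma macaulay_dual_generator_dual_form: "macaulay_dual_generator colored_ideal dual_form"
  unfolding macaulay_dual_generator_def
proof (intro conjI)
  obtain \<sigma> where "\<sigma> \<in> facets \<Delta>" using facet_above empty_face by blast
  then show "dual_form \<noteq> 0"
    using lookup_dual_form_face[of \<sigma>] facet_sign_nonzero_iff by force
  show "homogeneous dual_form"
    unfolding homogeneous_def
  proof (intro exI ballI)
    fix a assume "a \<in> keys dual_form"
    then obtain \<sigma> where "\<sigma> \<in> facets \<Delta>" "a = face_exponent \<sigma>"
      using lookup_dual_form_nonzero by (auto simp: in_keys_iff)
    then show "(\<Sum>v\<in>UNIV. lookup a v) = d + 1"
      by (simp add: lookup_face_exponent facets_iff sum.If_cases)
  qed
  have "contract g dual_form \<in> inverse_system colored_ideal" for g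
  proof -
    \<comment> \<open>The inverse system is closed under contraction because multiplication of
      polynomials is commutative.\<close>
    have "contract h (contract g dual_form) = contract g (contract h dual_form)" for h
      by (simp add: mult.commute flip: contract_mult)
    then show ?thesis using dual_form_in_inverse_system by (simp add: inverse_system_def)
  qed
  then show "inverse_system colored_ideal = {contract g dual_form |g. True}"
    using inverse_system_contraction by auto
qed

end

theorem lemma4p3:
  fixes \<Delta> B1 B2 :: "'v::{finite,linorder} set set"
    and d :: nat
    and \<rho> :: "'v \<Rightarrow> nat"
  assumes "homology_sphere TYPE('k::field) \<Delta>"
    and "complex_dim \<Delta> = int d"
    and "balanced_coloring \<Delta> d \<rho>"
    and "facet_ridge_bipartition \<Delta> B1 B2"
  shows "macaulay_dual_generator
           (ideal_plus (stanley_reisner_ideal \<Delta>)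
              (ideal_generated {colored_sop \<rho> i |i. i \<in> {1..d + 1}}))
           ((\<Sum>\<sigma>\<in>B1. face_monomial \<sigma>) - (\<Sum>\<sigma>\<in>B2. face_monomial \<sigma>) :: ('v, 'k) mpoly)"
proof -
  interpret bipartitioned_sphere "TYPE('k)" \<Delta> d \<rho> B1 B2
    by unfold_locales fact+
  show ?thesis using macaulay_dual_generator_dual_form unfolding dual_form_def .
qed

end
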